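(* Let $V$ be a finite set and let $\mathcal{P}$ be a complete collection of effect-margin pairs over $V$. Suppose that for some $v \in V$ and every non-empty $A \subseteq V \setminus \{v\}$, the sets $A \cup \{v\}$ and $A$ appear as effects within the same margin in $\mathcal{P}$. Then $\boldsymbol\lambda_{\mathcal{P}}$ is a smooth parameterization of the strictly positive distributions of $X_V$ if and only if $\boldsymbol\lambda_{\mathcal{P}_{-v}}$ is a smooth parameterization of the strictly positive distributions of $X_{V \setminus \{v\}}$, where $$\mathcal{P}_{-v} = \{(L, M \setminus \{v\}) : (L, M) \in \mathcal{P},\ v \notin L\}.$$ In addition, $\boldsymbol\lambda_{\mathcal{P}}$ is variation independent if and only if $\boldsymbol\lambda_{\mathcal{P}_{-v}}$ is variation independent.
   Context: $V$ is a finite set and $X_V = (X_v)_{v\in V}$ is a vector of binary random variables, $X_v \in \{0,1\}$, with strictly positive joint distribution $p_V$. For $M \subseteq V$, $p_M$ is the marginal distribution of $X_M = (X_v)_{v\in M}$, and $|x_L| = \sum_{v\in L} x_v$. Marginal log-linear parameters: for $L \subseteq M \subseteq V$, $$\lambda_L^M = 2^{-|M|} \sum_{x_M \in \{0,1\}^M} (-1)^{|x_L|} \log p_M(x_M);$$ $L$ is called the effect and $M$ the margin. Let $\mathcal{P}$ be a collection of effect-margin pairs $(L,M)$ with $\emptyset \neq L \subseteq M \subseteq V$, and put $\boldsymbol\lambda_{\mathcal{P}} = \boldsymbol\lambda_{\mathcal P}(p_V) = (\lambda_L^M : (L,M) \in \mathcal{P})$. $\mathcal{P}$ is complete (over $V$)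 if every non-empty subset of $V$ appears as an effect in $\mathcal{P}$ exactly once. Two effects $L, L'$ appear within the same margin if $(L,M),(L',M)\in\mathcal{P}$ for a common $M$. Smooth parameterization: let $\Delta^k$ be the set of strictly positive distributions $p_V$ on $\{0,1\}^V$, of dimension $k = 2^{|V|}-1$. A map $\theta : \Delta^k \to \Theta \subseteq \mathbb{R}^k$ is a smooth parameterization if it is a homeomorphism onto an open set $\Theta$, is twice continuously differentiable, and its Jacobian has full rank $k$ everywhere. The same definitions are used with $V \setminus \{v\}$ in place of $V$. A parameterization $\boldsymbol\lambda_{\mathcal{P}}$ is variation independent if its range over strictly positive distributions is all of $\mathbb{R}^{|\mathcal{P}|}$ (every real vector corresponds to a valid distribution). *)

theory Defs
  imports "HOL-Analysis.Analysis"
begin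

text \<open>
  Vectors indexed by a finite set \<open>I\<close> are the extensional functions \<open>I \<rightarrow>\<^sub>E UNIV\<close>, with the topology
  \<open>powertop_real I\<close>.
\<close>

section \<open>Strictly positive binary distributions and marginal log-linear parameters\<close>

definition states :: "'a set \<Rightarrow> ('a \<Rightarrow> nat) set" where
  "states M = (M \<rightarrow>\<^sub>E {0, 1})"

definition positive_dists :: "'a set \<Rightarrow> (('a \<Rightarrow> nat) \<Rightarrow> real) set" where
  "positive_dists V = {p \<in> states V \<rightarrow>\<^sub>E {0<..}. (\<Sum>x\<in>states V. p x) = 1}"

definition marginal :: "'a set \<Rightarrow> (('a \<Rightarrow> nat) \<Rightarrow> real) \<Rightarrow> 'a set \<Rightarrow> ('a \<Rightarrow> nat) \<Rightarrow> real" where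
  "marginal V p M y = (\<Sum>x | x \<in> states V \<and> restrict x M = y. p x)"

definition mll_param ::
    "'a set \<Rightarrow> (('a \<Rightarrow> nat) \<Rightarrow> real) \<Rightarrow> 'a set \<Rightarrow> 'a set \<Rightarrow> real" where
  "mll_param V p L M =
     (\<Sum>y\<in>states M. (-1) ^ (\<Sum>v\<in>L. y v) * ln (marginal V p M y)) / 2 ^ card M"

definition mll_vector ::
    "'a set \<Rightarrow> ('a set \<times> 'a set) set \<Rightarrow> (('a \<Rightarrow> nat) \<Rightarrow> real) \<Rightarrow> 'a set \<times> 'a set \<Rightarrow> real" where
  "mll_vector V P p = (\<lambda>(L, M)\<in>P. mll_param V p L M)"

section \<open>Collections of effect-margin pairs\<close>

definition effect_margin_pairs :: "'a set \<Rightarrow> ('a set \<times> 'a set) set \<Rightarrow> bool" where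
  "effect_margin_pairs V P \<longleftrightarrow> (\<forall>(L, M)\<in>P. L \<noteq> {} \<and> L \<subseteq> M \<and> M \<subseteq> V)"

definition complete_pairs :: "'a set \<Rightarrow> ('a set \<times> 'a set) set \<Rightarrow> bool" where
  "complete_pairs V P \<longleftrightarrow>
     effect_margin_pairs V P \<and> (\<forall>L. L \<noteq> {} \<and> L \<subseteq> V \<longrightarrow> (\<exists>!M. (L, M) \<in> P))"

definition within_same_margin ::
    "('a set \<times> 'a set) set \<Rightarrow> 'a set \<Rightarrow> 'a set \<Rightarrow> bool" where
  "within_same_margin P L L' \<longleftrightarrow> (\<exists>M. (L, M) \<in> P \<and> (L', M) \<in> P)"

definition remove_vertex :: "'a \<Rightarrow> ('a set \<times> 'a set) set \<Rightarrow> ('a set \<times> 'a set) set" where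
  "remove_vertex v P = {(L, M - {v}) | L M. (L, M) \<in> P \<and> v \<notin> L}"

section \<open>Smooth parameterizations and variation independence\<close>

definition partial_deriv :: "'i \<Rightarrow> (('i \<Rightarrow> real) \<Rightarrow> real) \<Rightarrow> ('i \<Rightarrow> real) \<Rightarrow> real" where
  "partial_deriv i f x = deriv (\<lambda>t. f (x(i := t))) (x i)"

text \<open>
  \<open>C_diff k I U f\<close>: all partial derivatives of \<open>f\<close> of order at most \<open>k\<close> in the coordinates \<open>I\<close> exist
  and are continuous on \<open>U\<close>. It is meant for \<open>U\<close> open in \<open>powertop_real I\<close>.
\<close>

primrec C_diff ::
    "nat \<Rightarrow> 'i set \<Rightarrow> ('i \<Rightarrow> real) set \<Rightarrow> (('i \<Rightarrow> real) \<Rightarrow> real) \<Rightarrow> bool" where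
  "C_diff 0 I U f \<longleftrightarrow> continuous_map (subtopology (powertop_real I) U) euclideanreal f"
| "C_diff (Suc k) I U f \<longleftrightarrow>
     continuous_map (subtopology (powertop_real I) U) euclideanreal f \<and>
     (\<forall>i\<in>I. (\<forall>x\<in>U. (\<lambda>t. f (x(i := t))) field_differentiable at (x i)) \<and>
            C_diff k I U (partial_deriv i f))"

text \<open>
  The library's \<open>rank\<close> needs matrices indexed by types. Here a matrix has the finite sets \<open>I\<close> of
  rows and \<open>J\<close> of columns, and its rank is the largest number of linearly independent columns.
\<close>

definition independent_columns :: "('i \<Rightarrow> 'j \<Rightarrow> real) \<Rightarrow> 'i set \<Rightarrow> 'j set \<Rightarrow> bool" where
  "independent_columns A I C \<longleftrightarrow>
     (\<forall>c. (\<forall>i\<in>I. (\<Sum>j\<in>C. c j * A i j) = 0) \<longrightarrow> (\<forall>j\<in>C. c j = 0))"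

definition matrix_rank :: "('i \<Rightarrow> 'j \<Rightarrow> real) \<Rightarrow> 'i set \<Rightarrow> 'j set \<Rightarrow> nat" where
  "matrix_rank A I J = Max (card ` {C. C \<subseteq> J \<and> independent_columns A I C})"

text \<open>
  Derivatives on the simplex are taken in the usual affine chart: the probabilities of all states
  except the all-zero state are free coordinates, and the latter's probability is one minus their
  sum. Any other choice of omitted state differs by an affine change of coordinates.
\<close>

definition zero_state :: "'a set \<Rightarrow> 'a \<Rightarrow> nat" where
  "zero_state V = (\<lambda>v\<in>V. 0)"

definition free_states :: "'a set \<Rightarrow> ('a \<Rightarrow> nat) set" where
  "free_states V = states V - {zero_state V}"

definition dist_of_coords ::
    "'a set \<Rightarrow> (('a \<Rightarrow> nat) \<Rightarrow> real) \<Rightarrow> (('a \<Rightarrow> nat) \<Rightarrow> real)" where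
  "dist_of_coords V q =
     (\<lambda>x\<in>states V. if x = zero_state V then 1 - (\<Sum>y\<in>free_states V. q y) else q x)"

definition coords_domain :: "'a set \<Rightarrow> (('a \<Rightarrow> nat) \<Rightarrow> real) set" where
  "coords_domain V = {q \<in> free_states V \<rightarrow>\<^sub>E UNIV. dist_of_coords V q \<in> positive_dists V}"

definition jacobian ::
    "'a set \<Rightarrow> ((('a \<Rightarrow> nat) \<Rightarrow> real) \<Rightarrow> 'j \<Rightarrow> real) \<Rightarrow>
     (('a \<Rightarrow> nat) \<Rightarrow> real) \<Rightarrow> 'j \<Rightarrow> ('a \<Rightarrow> nat) \<Rightarrow> real" where
  "jacobian V \<theta> q j x = partial_deriv x (\<lambda>q'. \<theta> (dist_of_coords V q') j) q"

text \<open>Here \<open>J\<close> indexes the coordinates of the parameter vector.\<close>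

definition smooth_parameterization ::
    "'a set \<Rightarrow> 'j set \<Rightarrow> ((('a \<Rightarrow> nat) \<Rightarrow> real) \<Rightarrow> 'j \<Rightarrow> real) \<Rightarrow> bool" where
  "smooth_parameterization V J \<theta> \<longleftrightarrow>
     finite J \<and> card J = 2 ^ card V - 1 \<and>
     (\<exists>\<Theta>. openin (powertop_real J) \<Theta> \<and>
          homeomorphic_map (subtopology (powertop_real (states V)) (positive_dists V))
            (subtopology (powertop_real J) \<Theta>) \<theta>) \<and>
     (\<forall>j\<in>J. C_diff 2 (free_states V) (coords_domain V) (\<lambda>q. \<theta> (dist_of_coords V q) j)) \<and>
     (\<forall>q\<in>coords_domain V. matrix_rank (jacobian V \<theta> q) J (free_states V) = 2 ^ card V - 1)"

definition variation_independent :: "'a set \<Rightarrow> ('a set \<times> 'a set) set \<Rightarrow> bool" where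
  "variation_independent V P \<longleftrightarrow> mll_vector V P ` positive_dists V = (P \<rightarrow>\<^sub>E UNIV)"

end

theory Submission
  imports Defs
begin

text \<open>
  Since every margin contains \<open>v\<close>, the parameters of \<open>A\<close> and \<open>A \<union> {v}\<close> in a common margin \<open>M\<close> have
  as sum and difference the parameters of \<open>A\<close> in the margin \<open>M - {v}\<close> of the conditional
  distributions given \<open>X\<^sub>v = 0\<close> and \<open>X\<^sub>v = 1\<close>: the normalizing constants cancel because \<open>A\<close> is
  non-empty. So, up to an invertible linear map, the parameterization sends \<open>p\<close> to the reduced
  parameters of both conditional distributions together with the parameter of \<open>{v}\<close>, which is
  half the log-odds of \<open>X\<^sub>v = 0\<close> plus a function of the conditional distributions. Surjectivity,
  homeomorphy and injectivity of the derivative each transfer through this triangular structure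
  in both directions, while smoothness of the parameters is automatic.
\<close>

section \<open>States, marginals and contrasts\<close>

text \<open>Slices of a distribution are not normalized, and slices of a direction of total zero
  need not have total zero. Parameters and their derivatives are therefore studied for arbitrary
  positive functions. Scaling is seen by the empty effect alone, and that effect arises only as what
  slicing leaves of \<open>{v}\<close>, the one effect that the hypothesis gives no partner. Its
  values in the two slices carry the log-odds of \<open>X_v\<close>, so the equation at
  \<open>{v}\<close> can be solved for the weight by the logistic function, whatever the conditional
  distributions are. Hence, upward, every object is assembled from two objects over
  \<open>V - {v}\<close> and one real number. Downward, one slice is kept and the other is filled
  in, by a copy of the same data or by common data when two distributions are compared, with the
  value at \<open>{v}\<close> adjusted. Full rank is first freed from the affine chart, whose
  omitted state lies in one slice only, and becomes injectivity on functions of total zero.\<close>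

lemma finite_states: "finite V \<Longrightarrow> finite (states V)"
  unfolding states_def by (intro finite_PiE) auto

lemma card_states: "finite V \<Longrightarrow> card (states V) = 2 ^ card V"
  unfolding states_def by (simp add: card_PiE numeral_2_eq_2)

lemma upd_in_states: "x \<in> states (V - {v}) \<Longrightarrow> v \<in> V \<Longrightarrow> i \<in> {0, 1} \<Longrightarrow> x(v := i) \<in> states V"
  unfolding states_def by (force simp: PiE_iff extensional_def)

lemma sum_states_split:
  fixes g :: "('a \<Rightarrow> nat) \<Rightarrow> 'b::comm_monoid_add"
  assumes "v \<in> V"
  shows "(\<Sum>x\<in>states V. g x) = (\<Sum>x\<in>states (V - {v}). g (x(v := 0))) + (\<Sum>x\<in>states (V - {v}). g (x(v := 1)))"
proof -
  have V: "V = insert v (V - {v})" using assms by auto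
  have eq: "states V = (\<lambda>(i, x). x(v := i)) ` ({0, 1} \<times> states (V - {v}))"
    unfolding states_def by (subst V, subst PiE_insert_eq) simp
  have inj: "inj_on (\<lambda>(i, x). x(v := i)) ({0, 1} \<times> states (V - {v}))"
    unfolding states_def using inj_combinator[of v "V - {v}" "\<lambda>_. {0, 1::nat}"] by simp
  have "(\<Sum>x\<in>states V. g x) = (\<Sum>(i, x)\<in>{0, 1} \<times> states (V - {v}). g (x(v := i)))"
    unfolding eq by (subst sum.reindex[OF inj]) (simp add: case_prod_unfold)
  also have "\<dots> = (\<Sum>i\<in>{0, 1}. \<Sum>x\<in>states (V - {v}). g (x(v := i)))"
    by (rule sum.cartesian_product[symmetric])
  finally show ?thesis by simp
qed

text \<open>The Walsh-Hadamard coefficient of \<open>g\<close> at \<open>L\<close> on the cube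
  \<open>states M\<close>. Taking \<open>g\<close> as a log marginal gives a parameter, and as a
  ratio of marginals its derivative, so both share the rules below.\<close>

definition contrast :: "'a set \<Rightarrow> 'a set \<Rightarrow> (('a \<Rightarrow> nat) \<Rightarrow> real) \<Rightarrow> real" where
  "contrast L M g = (\<Sum>y\<in>states M. (-1) ^ (\<Sum>v\<in>L. y v) * g y) / 2 ^ card M"

lemma mll_param_contrast: "mll_param V p L M = contrast L M (\<lambda>y. ln (marginal V p M y))"
  by (simp add: mll_param_def contrast_def)

lemma contrast_cong: "(\<And>y. y \<in> states M \<Longrightarrow> g y = h y) \<Longrightarrow> contrast L M g = contrast L M h"
  unfolding contrast_def by (metis (no_types, lifting) sum.cong)

lemma contrast_add: "contrast L M (\<lambda>y. g y + h y) = contrast L M g + contrast L M h"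
  by (simp add: contrast_def distrib_left sum.distrib add_divide_distrib)

lemma contrast_cmult: "contrast L M (\<lambda>y. c * g y) = c * contrast L M g"
  by (simp add: contrast_def sum_distrib_left mult.left_commute)

lemma contrast_sum: "contrast L M (\<lambda>y. \<Sum>i\<in>I. g i y) = (\<Sum>i\<in>I. contrast L M (g i))"
  unfolding contrast_def sum_divide_distrib sum_distrib_left by (rule sum.swap)

text \<open>The two faces of the cube in direction \<open>v\<close> carry the same sign pattern for
  \<open>L\<close>, while for \<open>insert v L\<close> the sign flips on the face
  \<open>v = 1\<close>. The factor 1/2 is lost from the normalization when the dimension drops by
  one.\<close>

lemma
  assumes "finite M" "v \<in> M" "L \<subseteq> M - {v}"
  shows contrast_split: "contrast L M g =
      (contrast L (M - {v}) (\<lambda>y. g (y(v := 0))) + contrast L (M - {v}) (\<lambda>y. g (y(v := 1)))) / 2"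
    and contrast_split_insert: "contrast (insert v L) M g =
      (contrast L (M - {v}) (\<lambda>y. g (y(v := 0))) - contrast L (M - {v}) (\<lambda>y. g (y(v := 1)))) / 2"
proof -
  have card: "(2::real) ^ card M = 2 * 2 ^ card (M - {v})"
    using assms by (metis card.remove power_Suc)
  have vL: "v \<notin> L" and fL: "finite L" using assms by (auto intro: finite_subset)
  have s: "(\<Sum>w\<in>L. (y(v := i)) w) = (\<Sum>w\<in>L. y w)" for y :: "'a \<Rightarrow> nat" and i
    using vL by (intro sum.cong) auto
  show "contrast L M g =
      (contrast L (M - {v}) (\<lambda>y. g (y(v := 0))) + contrast L (M - {v}) (\<lambda>y. g (y(v := 1)))) / 2"
    unfolding contrast_def sum_states_split[OF assms(2)] s card by (simp add: field_simps)
  show "contrast (insert v L) M g =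
      (contrast L (M - {v}) (\<lambda>y. g (y(v := 0))) - contrast L (M - {v}) (\<lambda>y. g (y(v := 1)))) / 2"
    unfolding contrast_def sum_states_split[OF assms(2)] card
    using vL fL by (simp add: s[simplified] sum_negf field_simps)
qed

text \<open>For \<open>v\<close> in \<open>L\<close> the faces \<open>v = 0\<close> and
  \<open>v = 1\<close> contribute opposite values and cancel. The empty effect is the mean and keeps
  the constant; it is included because slicing \<open>{v}\<close> leads to it.\<close>

lemma contrast_const:
  assumes "finite M" "L \<subseteq> M"
  shows "contrast L M (\<lambda>_. c) = (if L = {} then c else 0)"
proof (cases "L = {}")
  case True
  then show ?thesis using card_states[OF assms(1)] by (simp add: contrast_def)
next
  case False
  then obtain v where v: "v \<in> L" by auto
  then have "contrast (insert v (L - {v})) M (\<lambda>_. c) = 0"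
    using assms by (subst contrast_split_insert) auto
  then show ?thesis using v False by (simp add: insert_absorb)
qed

section \<open>Marginals and their slices\<close>

lemma marginal_cong: "(\<And>x. x \<in> states V \<Longrightarrow> p x = q x) \<Longrightarrow> marginal V p M y = marginal V q M y"
  unfolding marginal_def by (intro sum.cong) auto

lemma marginal_add: "marginal V (\<lambda>x. p x + q x) M y = marginal V p M y + marginal V q M y"
  by (simp add: marginal_def sum.distrib)

lemma marginal_cmult: "marginal V (\<lambda>x. c * p x) M y = c * marginal V p M y"
  by (simp add: marginal_def sum_distrib_left)

lemma marginal_sum: "marginal V (\<lambda>x. \<Sum>i\<in>I. p i x) M y = (\<Sum>i\<in>I. marginal V (p i) M y)"
  unfolding marginal_def by (rule sum.swap)

lemma marginal_pos:
  assumes "finite V" "M \<subseteq> V" "y \<in> states M" "\<And>x. x \<in> states V \<Longrightarrow> 0 < p x"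
  shows "0 < marginal V p M y"
  unfolding marginal_def
proof (rule sum_pos)
  have "(\<lambda>u\<in>V. if u \<in> M then y u else 0) \<in> states V"
    using assms(2,3) by (fastforce simp: states_def PiE_iff)
  moreover have "restrict (\<lambda>u\<in>V. if u \<in> M then y u else 0) M = y"
    using assms(2,3) by (intro ext) (auto simp: states_def PiE_iff extensional_def restrict_def)
  ultimately show "{x \<in> states V. restrict x M = y} \<noteq> {}" by blast
qed (use assms(4) finite_states[OF assms(1)] in auto)

text \<open>Since \<open>v\<close> lies in the margin, marginalizing sums out other coordinates only
  and so commutes with fixing \<open>x v = i\<close>.\<close>

lemma marginal_slice:
  assumes "finite V" "v \<in> M" "M \<subseteq> V" "y \<in> states (M - {v})" "i \<in> {0, 1}"
  shows "marginal V p M (y(v := i)) = marginal (V - {v}) (\<lambda>x. p (x(v := i))) (M - {v}) y"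
proof -
  have fin: "finite (states V)" "finite (states (V - {v}))"
    using assms(1) by (auto intro: finite_states)
  have m: "marginal U q N z = (\<Sum>x\<in>states U. if restrict x N = z then q x else 0)"
    if "finite (states U)" for U N z and q :: "('a \<Rightarrow> nat) \<Rightarrow> real"
    unfolding marginal_def by (rule sum.inter_filter[OF that])
  have r: "restrict (x(v := j)) M = y(v := i) \<longleftrightarrow> j = i \<and> restrict x (M - {v}) = y" for x j
  proof
    assume eq: "restrict (x(v := j)) M = y(v := i)"
    have "restrict x (M - {v}) u = y u" for u
    proof (cases "u = v")
      case True
      then show ?thesis using assms(4) by (simp add: states_def PiE_iff extensional_def)
    next
      case False
      then show ?thesis using fun_cong[OF eq, of u] by (simp add: restrict_def split: if_splits)
    qed
    then show "j = i \<and> restrict x (M - {v}) = y" using fun_cong[OF eq, of v] assms(2) by auto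
  next
    assume "j = i \<and> restrict x (M - {v}) = y"
    then show "restrict (x(v := j)) M = y(v := i)" using assms(2) by (auto simp: restrict_def)
  qed
  have v: "v \<in> V" using assms by auto
  show ?thesis
    unfolding m[OF fin(1)] m[OF fin(2)] sum_states_split[OF v] r
    using assms(5) by (auto simp del: One_nat_def)
qed

text \<open>The derivative of \<^const>\<open>mll_param\<close> at \<open>p\<close> in the direction \<open>d\<close>.\<close>

definition mll_deriv ::
    "'a set \<Rightarrow> (('a \<Rightarrow> nat) \<Rightarrow> real) \<Rightarrow> (('a \<Rightarrow> nat) \<Rightarrow> real) \<Rightarrow> 'a set \<Rightarrow> 'a set \<Rightarrow> real" where
  "mll_deriv V p d L M = contrast L M (\<lambda>y. marginal V d M y / marginal V p M y)"

text \<open>The slices stay unnormalized, which makes these identities hold for any \<open>p\<close>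
  and \<open>d\<close>; normalization is a separate scaling step.\<close>

lemma
  assumes "finite V" "v \<in> M" "M \<subseteq> V" "A \<subseteq> M - {v}"
  shows mll_param_split: "mll_param V p A M =
      (mll_param (V - {v}) (\<lambda>x. p (x(v := 0))) A (M - {v}) +
       mll_param (V - {v}) (\<lambda>x. p (x(v := 1))) A (M - {v})) / 2"
    and mll_param_split_insert: "mll_param V p (insert v A) M =
      (mll_param (V - {v}) (\<lambda>x. p (x(v := 0))) A (M - {v}) -
       mll_param (V - {v}) (\<lambda>x. p (x(v := 1))) A (M - {v})) / 2"
    and mll_deriv_split: "mll_deriv V p d A M =
      (mll_deriv (V - {v}) (\<lambda>x. p (x(v := 0))) (\<lambda>x. d (x(v := 0))) A (M - {v}) +
       mll_deriv (V - {v}) (\<lambda>x. p (x(v := 1))) (\<lambda>x. d (x(v := 1))) A (M - {v})) / 2"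
    and mll_deriv_split_insert: "mll_deriv V p d (insert v A) M =
      (mll_deriv (V - {v}) (\<lambda>x. p (x(v := 0))) (\<lambda>x. d (x(v := 0))) A (M - {v}) -
       mll_deriv (V - {v}) (\<lambda>x. p (x(v := 1))) (\<lambda>x. d (x(v := 1))) A (M - {v})) / 2"
proof -
  have fM: "finite M" using assms finite_subset by blast
  note split = contrast_split[OF fM assms(2,4)] contrast_split_insert[OF fM assms(2,4)]
  note slice = marginal_slice[OF assms(1-3)]
  \<comment> \<open>A generic \<open>F\<close> serves the parameters, with
    \<open>F a b = ln a\<close>, and the derivatives, with \<open>F a b = b / a\<close>.\<close>
  have c: "contrast A (M - {v}) (\<lambda>y. F (marginal V p M (y(v := i))) (marginal V d M (y(v := i)))) =
      contrast A (M - {v}) (\<lambda>y. F (marginal (V - {v}) (\<lambda>x. p (x(v := i))) (M - {v}) y)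
        (marginal (V - {v}) (\<lambda>x. d (x(v := i))) (M - {v}) y))" if "i \<in> {0, 1}" for i F d
    by (rule contrast_cong) (simp add: slice[OF _ that])
  note c0 = c[OF insertI1] and c1 = c[OF insertI2[OF singletonI]]
  note ln = c0[of "\<lambda>a b. ln a"] c1[of "\<lambda>a b. ln a"]
  note dv = c0[of "\<lambda>a b. b / a"] c1[of "\<lambda>a b. b / a"]
  show "mll_param V p A M =
      (mll_param (V - {v}) (\<lambda>x. p (x(v := 0))) A (M - {v}) +
       mll_param (V - {v}) (\<lambda>x. p (x(v := 1))) A (M - {v})) / 2"
    unfolding mll_param_contrast split ln by simp
  show "mll_param V p (insert v A) M =
      (mll_param (V - {v}) (\<lambda>x. p (x(v := 0))) A (M - {v}) -
       mll_param (V - {v}) (\<lambda>x. p (x(v := 1))) A (M - {v})) / 2"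
    unfolding mll_param_contrast split ln by simp
  show "mll_deriv V p d A M =
      (mll_deriv (V - {v}) (\<lambda>x. p (x(v := 0))) (\<lambda>x. d (x(v := 0))) A (M - {v}) +
       mll_deriv (V - {v}) (\<lambda>x. p (x(v := 1))) (\<lambda>x. d (x(v := 1))) A (M - {v})) / 2"
    unfolding mll_deriv_def split dv by simp
  show "mll_deriv V p d (insert v A) M =
      (mll_deriv (V - {v}) (\<lambda>x. p (x(v := 0))) (\<lambda>x. d (x(v := 0))) A (M - {v}) -
       mll_deriv (V - {v}) (\<lambda>x. p (x(v := 1))) (\<lambda>x. d (x(v := 1))) A (M - {v})) / 2"
    unfolding mll_deriv_def split dv by simp
qed

lemma mll_param_cong: "(\<And>x. x \<in> states V \<Longrightarrow> p x = q x) \<Longrightarrow> mll_param V p L M = mll_param V q L M"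
  unfolding mll_param_def by (simp cong: marginal_cong)

lemma mll_deriv_cong:
  "(\<And>x. x \<in> states V \<Longrightarrow> p x = q x) \<Longrightarrow> (\<And>x. x \<in> states V \<Longrightarrow> d x = e x) \<Longrightarrow>
    mll_deriv V p d L M = mll_deriv V q e L M"
  unfolding mll_deriv_def by (simp cong: marginal_cong)

text \<open>Scaling adds the constant \<open>ln c\<close> to every log marginal, and only the empty
  effect sees constants.\<close>

lemma mll_param_scale:
  assumes "finite V" "M \<subseteq> V" "L \<subseteq> M" "\<And>x. x \<in> states V \<Longrightarrow> 0 < p x" "0 < c"
  shows "mll_param V (\<lambda>x. c * p x) L M = (if L = {} then ln c else 0) + mll_param V p L M"
proof -
  have fM: "finite M" using assms finite_subset by blast
  have "mll_param V (\<lambda>x. c * p x) L M = contrast L M (\<lambda>y. ln c + ln (marginal V p M y))"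
    unfolding mll_param_contrast
  proof (intro contrast_cong)
    fix y assume "y \<in> states M"
    then show "ln (marginal V (\<lambda>x. c * p x) M y) = ln c + ln (marginal V p M y)"
      using marginal_pos[OF assms(1,2) _ assms(4)] assms(5) by (simp add: marginal_cmult ln_mult_pos)
  qed
  then show ?thesis
    by (simp add: contrast_add contrast_const[OF fM assms(3)] mll_param_contrast)
qed

lemma mll_deriv_add: "mll_deriv V p (\<lambda>x. d x + e x) L M = mll_deriv V p d L M + mll_deriv V p e L M"
  by (simp add: mll_deriv_def marginal_add add_divide_distrib contrast_add)

lemma mll_deriv_cmult: "mll_deriv V p (\<lambda>x. c * d x) L M = c * mll_deriv V p d L M"
  by (simp add: mll_deriv_def marginal_cmult flip: contrast_cmult)

lemma mll_deriv_sum: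
  "mll_deriv V p (\<lambda>x. \<Sum>i\<in>I. c i * d i x) L M = (\<Sum>i\<in>I. c i * mll_deriv V p (d i) L M)"
  by (simp add: mll_deriv_def marginal_sum marginal_cmult sum_divide_distrib contrast_sum
      flip: contrast_cmult)

lemma mll_deriv_base_cmult: "mll_deriv V (\<lambda>x. c * p x) d L M = mll_deriv V p d L M / c"
  using contrast_cmult[of L M "1 / c" "\<lambda>y. marginal V d M y / marginal V p M y"]
  by (simp add: mll_deriv_def marginal_cmult mult.commute)

text \<open>The direction \<open>p\<close> is that of scaling, so every ratio of marginals is 1.
  This is the infinitesimal form of \<open>mll_param_scale\<close>.\<close>

lemma mll_deriv_self:
  assumes "finite V" "M \<subseteq> V" "L \<subseteq> M" "\<And>x. x \<in> states V \<Longrightarrow> 0 < p x"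
  shows "mll_deriv V p p L M = (if L = {} then 1 else 0)"
proof -
  have fM: "finite M" using assms finite_subset by blast
  have "mll_deriv V p p L M = contrast L M (\<lambda>_. 1)"
    unfolding mll_deriv_def using marginal_pos[OF assms(1,2) _ assms(4)]
    by (intro contrast_cong) force
  then show ?thesis by (simp add: contrast_const[OF fM assms(3)])
qed

section \<open>Positive distributions and the size of a complete collection\<close>

lemma positive_distsD:
  assumes "p \<in> positive_dists V"
  shows "x \<in> states V \<Longrightarrow> 0 < p x" and "(\<Sum>x\<in>states V. p x) = 1" and "p \<in> extensional (states V)"
  using assms by (auto simp: positive_dists_def PiE_iff)

lemma positive_distsI:
  "(\<And>x. x \<in> states V \<Longrightarrow> 0 < p x) \<Longrightarrow> (\<Sum>x\<in>states V. p x) = 1 \<Longrightarrow> p \<in> extensional (states V) \<Longrightarrow>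
    p \<in> positive_dists V"
  by (auto simp: positive_dists_def PiE_iff)

lemma states_nonempty: "states V \<noteq> {}"
  unfolding states_def by (simp add: PiE_eq_empty_iff)

lemma zero_state_in_states: "zero_state V \<in> states V"
  by (auto simp: zero_state_def states_def)

lemma complete_pairs_card:
  assumes "finite V" "complete_pairs V P"
  shows "finite P \<and> card P = 2 ^ card V - 1"
proof -
  have P: "L \<noteq> {} \<and> L \<subseteq> V" if "(L, M) \<in> P" for L M
    using assms(2) that unfolding complete_pairs_def effect_margin_pairs_def by fast
  have ex1: "\<exists>!M. (L, M) \<in> P" if "L \<noteq> {}" "L \<subseteq> V" for L
    using assms(2) that unfolding complete_pairs_def by simp
  have "bij_betw fst P (Pow V - {{}})"
    unfolding bij_betw_def
  proof
    show "inj_on fst P"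
    proof (rule inj_onI)
      fix x y assume "x \<in> P" "y \<in> P" "fst x = fst y"
      then show "x = y" using P[of "fst x" "snd x"] ex1[of "fst x"] by (cases x; cases y) auto
    qed
    show "fst ` P = Pow V - {{}}"
    proof
      show "fst ` P \<subseteq> Pow V - {{}}" by (auto dest!: P)
      show "Pow V - {{}} \<subseteq> fst ` P"
      proof
        fix L assume "L \<in> Pow V - {{}}"
        then obtain M where "(L, M) \<in> P" using ex1[of L] by auto
        then show "L \<in> fst ` P" by force
      qed
    qed
  qed
  moreover have "card (Pow V - {{}}) = 2 ^ card V - 1"
    using assms(1) by (simp add: card_Pow)
  ultimately show ?thesis
    using assms(1) by (simp add: bij_betw_finite bij_betw_same_card)
qed

section \<open>The Jacobian as a directional derivative\<close>

text \<open>The tangent direction of the chart: raising the free coordinate \<open>x\<close> takes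
  the same mass from the zero state.\<close>

definition coord_dir :: "'a set \<Rightarrow> ('a \<Rightarrow> nat) \<Rightarrow> ('a \<Rightarrow> nat) \<Rightarrow> real" where
  "coord_dir V x z = of_bool (z = x) - of_bool (z = zero_state V)"

lemma dist_of_coords_upd:
  assumes "finite V" "x \<in> free_states V" "z \<in> states V"
  shows "dist_of_coords V (q(x := t)) z = dist_of_coords V q z + (t - q x) * coord_dir V x z"
proof -
  have fin: "finite (free_states V)" using finite_states[OF assms(1)] by (simp add: free_states_def)
  have "(\<Sum>y\<in>free_states V. (q(x := t)) y) = t + (\<Sum>y\<in>free_states V - {x}. (q(x := t)) y)"
    using assms fin by (subst sum.remove[of _ x]) auto
  also have "(\<Sum>y\<in>free_states V - {x}. (q(x := t)) y) = (\<Sum>y\<in>free_states V - {x}. q y)"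
    by (intro sum.cong) auto
  also have "\<dots> = (\<Sum>y\<in>free_states V. q y) - q x"
    using assms fin by (simp add: sum_diff1)
  finally show ?thesis
    using assms by (auto simp: dist_of_coords_def coord_dir_def free_states_def)
qed

lemma sum_states_zero_free:
  "finite V \<Longrightarrow> (\<Sum>x\<in>states V. g x) = g (zero_state V) + (\<Sum>x\<in>free_states V. g x)"
  for g :: "_ \<Rightarrow> real"
  unfolding free_states_def by (rule sum.remove[OF finite_states zero_state_in_states])

lemma sum_dist_of_coords: "finite V \<Longrightarrow> (\<Sum>x\<in>states V. dist_of_coords V q x) = 1"
proof -
  assume "finite V"
  moreover have "(\<Sum>x\<in>free_states V. dist_of_coords V q x) = (\<Sum>x\<in>free_states V. q x)"
    by (intro sum.cong) (auto simp: dist_of_coords_def free_states_def)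
  ultimately show ?thesis
    unfolding sum_states_zero_free[OF \<open>finite V\<close>]
    by (simp only:) (simp add: zero_state_in_states dist_of_coords_def)
qed

lemma positive_dists_coords:
  assumes "finite V" "p \<in> positive_dists V"
  shows "restrict p (free_states V) \<in> coords_domain V"
    and "dist_of_coords V (restrict p (free_states V)) = p"
proof -
  have "dist_of_coords V (restrict p (free_states V)) x = p x" for x
    using positive_distsD(2,3)[OF assms(2)] sum_states_zero_free[OF assms(1), of p]
    by (auto simp: dist_of_coords_def free_states_def extensional_def)
  then show "dist_of_coords V (restrict p (free_states V)) = p" ..
  then show "restrict p (free_states V) \<in> coords_domain V"
    using assms by (simp add: coords_domain_def)
qed

text \<open>The form of openness that partial derivatives need. Only finitely many strict
  inequalities, each affine in \<open>t\<close>, are at stake, because the chart keeps the total at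
  1.\<close>

lemma eventually_coords_domain:
  assumes "finite V" "q \<in> coords_domain V" "x \<in> free_states V"
  shows "eventually (\<lambda>t. q(x := t) \<in> coords_domain V) (nhds (q x))"
proof -
  have p: "dist_of_coords V q \<in> positive_dists V" and q: "q \<in> extensional (free_states V)"
    using assms by (auto simp: coords_domain_def PiE_iff)
  have "eventually (\<lambda>t. 0 < dist_of_coords V q z + (t - q x) * coord_dir V x z) (nhds (q x))"
    if "z \<in> states V" for z
  proof -
    have "((\<lambda>t. dist_of_coords V q z + (t - q x) * coord_dir V x z) \<longlongrightarrow>
        dist_of_coords V q z + (q x - q x) * coord_dir V x z) (nhds (q x))"
      by (intro tendsto_intros filterlim_ident)
    then show ?thesis
      using positive_distsD(1)[OF p that] by (auto elim: order_tendstoD(1))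
  qed
  then have "eventually (\<lambda>t. \<forall>z\<in>states V. 0 < dist_of_coords V (q(x := t)) z) (nhds (q x))"
    using assms by (intro eventually_ball_finite finite_states) (auto simp: dist_of_coords_upd)
  then show ?thesis
  proof eventually_elim
    case (elim t)
    then have "dist_of_coords V (q(x := t)) \<in> positive_dists V"
      by (intro positive_distsI sum_dist_of_coords assms(1)) (simp_all add: dist_of_coords_def)
    then show ?case
      using q assms(3) by (auto simp: coords_domain_def PiE_iff extensional_def)
  qed
qed

lemma marginal_dist_of_coords_upd:
  assumes "finite V" "x \<in> free_states V"
  shows "marginal V (dist_of_coords V (q(x := t))) M y =
    marginal V (dist_of_coords V q) M y + (t - q x) * marginal V (coord_dir V x) M y"
  using assms by (simp add: dist_of_coords_upd marginal_add marginal_cmult cong: marginal_cong)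

text \<open>Along one chart coordinate each marginal is affine in \<open>t\<close>, so
  differentiating its logarithm produces the ratio in \<open>mll_deriv\<close>.\<close>

lemma jacobian_mll_vector:
  assumes "finite V" "q \<in> coords_domain V" "x \<in> free_states V" "(L, M) \<in> P" "M \<subseteq> V"
  shows "jacobian V (mll_vector V P) q (L, M) x = mll_deriv V (dist_of_coords V q) (coord_dir V x) L M"
proof -
  have p: "dist_of_coords V q \<in> positive_dists V" using assms by (simp add: coords_domain_def)
  have "((\<lambda>t. \<Sum>y\<in>states M. (- 1) ^ (\<Sum>v\<in>L. y v) *
      ln (marginal V (dist_of_coords V q) M y + (t - q x) * marginal V (coord_dir V x) M y))
    has_real_derivative (\<Sum>y\<in>states M. (- 1) ^ (\<Sum>v\<in>L. y v) *
      (marginal V (coord_dir V x) M y / marginal V (dist_of_coords V q) M y))) (at (q x))"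
  proof (intro DERIV_sum DERIV_cmult)
    fix y assume "y \<in> states M"
    then have "0 < marginal V (dist_of_coords V q) M y"
      using marginal_pos[OF assms(1,5)] positive_distsD(1)[OF p] by blast
    then show "((\<lambda>t. ln (marginal V (dist_of_coords V q) M y + (t - q x) * marginal V (coord_dir V x) M y))
      has_real_derivative marginal V (coord_dir V x) M y / marginal V (dist_of_coords V q) M y) (at (q x))"
      by (auto intro!: derivative_eq_intros)
  qed
  then have "((\<lambda>t. mll_param V (dist_of_coords V (q(x := t))) L M)
    has_real_derivative mll_deriv V (dist_of_coords V q) (coord_dir V x) L M) (at (q x))"
    unfolding mll_param_def mll_deriv_def contrast_def marginal_dist_of_coords_upd[OF assms(1,3)]
    by (rule DERIV_cdivide)
  then show ?thesis
    using assms(4) by (simp add: jacobian_def partial_deriv_def mll_vector_def DERIV_imp_deriv)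
qed

text \<open>An independent set of \<open>card J\<close> columns inside the finite set
  \<open>J\<close> can only be \<open>J\<close> itself. Full column rank thus becomes
  injectivity.\<close>

lemma matrix_rank_full_iff:
  assumes "finite J"
  shows "matrix_rank A I J = card J \<longleftrightarrow> independent_columns A I J"
proof -
  let ?S = "{C. C \<subseteq> J \<and> independent_columns A I C}"
  have fin: "finite (card ` ?S)" using assms by auto
  have ne: "{} \<in> ?S" by (simp add: independent_columns_def)
  have le: "C \<in> ?S \<Longrightarrow> card C \<le> card J" for C using assms by (simp add: card_mono)
  show ?thesis
  proof
    assume "matrix_rank A I J = card J"
    then have "card J \<in> card ` ?S"
      unfolding matrix_rank_def using Max_in[OF fin] ne by (metis empty_iff image_eqI)
    then obtain C where "C \<in> ?S" "card C = card J" by auto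
    then show "independent_columns A I J" using assms card_subset_eq by blast
  next
    assume "independent_columns A I J"
    then have "card J \<in> card ` ?S" by auto
    then show "matrix_rank A I J = card J"
      unfolding matrix_rank_def using fin le by (intro Max_eqI) auto
  qed
qed

text \<open>Injectivity of the derivative on the tangent space of the simplex, the functions of
  total zero, stated without the chart.\<close>

definition nondegenerate :: "'a set \<Rightarrow> ('a set \<times> 'a set) set \<Rightarrow> bool" where
  "nondegenerate V P \<longleftrightarrow> (\<forall>p\<in>positive_dists V. \<forall>d. (\<Sum>x\<in>states V. d x) = 0 \<longrightarrow>
     (\<forall>(L, M)\<in>P. mll_deriv V p d L M = 0) \<longrightarrow> (\<forall>x\<in>states V. d x = 0))"

text \<open>The directions \<open>coord_dir\<close> form a basis of the functions of total zero: the
  coefficients are the values at the free states, and the zero state balances them.\<close>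

lemma sum_coord_dir:
  assumes "finite V" "z \<in> states V"
  shows "(\<Sum>x\<in>free_states V. c x * coord_dir V x z) =
    (if z = zero_state V then - (\<Sum>x\<in>free_states V. c x) else c z)"
proof -
  have fin: "finite (free_states V)" using finite_states[OF assms(1)] by (simp add: free_states_def)
  show ?thesis
  proof (cases "z = zero_state V")
    case True
    then have "(\<Sum>x\<in>free_states V. c x * coord_dir V x z) = (\<Sum>x\<in>free_states V. - c x)"
      by (intro sum.cong) (auto simp: coord_dir_def free_states_def)
    then show ?thesis using True by (simp add: sum_negf)
  next
    case False
    then have "(\<Sum>x\<in>free_states V. c x * coord_dir V x z) =
        (\<Sum>x\<in>free_states V. if z = x then c x else 0)"
      by (intro sum.cong) (auto simp: coord_dir_def)
    then show ?thesis using False assms fin by (simp add: free_states_def)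
  qed
qed

text \<open>By linearity a combination of Jacobian columns is the derivative in the combined
  direction, and these combinations are all the directions of total zero.\<close>

lemma full_rank_iff_nondegenerate:
  assumes "finite V" "effect_margin_pairs V P"
  shows "(\<forall>q\<in>coords_domain V. matrix_rank (jacobian V (mll_vector V P) q) P (free_states V) = 2 ^ card V - 1)
    \<longleftrightarrow> nondegenerate V P"
proof -
  have fin: "finite (free_states V)" using finite_states[OF assms(1)] by (simp add: free_states_def)
  have "card (free_states V) = 2 ^ card V - 1"
    using assms(1) by (simp add: free_states_def card_states zero_state_in_states)
  moreover have "matrix_rank (jacobian V (mll_vector V P) q) P (free_states V) = card (free_states V)
      \<longleftrightarrow> (\<forall>c. (\<forall>(L, M)\<in>P. mll_deriv V (dist_of_coords V q)
          (\<lambda>z. \<Sum>x\<in>free_states V. c x * coord_dir V x z) L M = 0) \<longrightarrow> (\<forall>x\<in>free_states V. c x = 0))"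
    if q: "q \<in> coords_domain V" for q
  proof -
    have "(\<Sum>x\<in>free_states V. c x * jacobian V (mll_vector V P) q (L, M) x) =
        mll_deriv V (dist_of_coords V q) (\<lambda>z. \<Sum>x\<in>free_states V. c x * coord_dir V x z) L M"
      if "(L, M) \<in> P" for L M c
      unfolding mll_deriv_sum using assms q that
      by (intro sum.cong) (auto simp: jacobian_mll_vector effect_margin_pairs_def)
    then show ?thesis
      unfolding matrix_rank_full_iff[OF fin] independent_columns_def
      by (intro iff_allI imp_cong ball_cong) auto
  qed
  moreover have "(\<forall>q\<in>coords_domain V. \<forall>c. (\<forall>(L, M)\<in>P. mll_deriv V (dist_of_coords V q)
          (\<lambda>z. \<Sum>x\<in>free_states V. c x * coord_dir V x z) L M = 0) \<longrightarrow> (\<forall>x\<in>free_states V. c x = 0))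
      \<longleftrightarrow> nondegenerate V P" (is "?lhs \<longleftrightarrow> _")
  proof
    assume lhs: ?lhs
    show "nondegenerate V P"
      unfolding nondegenerate_def
    proof (intro ballI allI impI)
      fix p d x
      assume p: "p \<in> positive_dists V" and d: "(\<Sum>x\<in>states V. d x) = 0"
        and D: "\<forall>(L, M)\<in>P. mll_deriv V p d L M = 0" and x: "x \<in> states V"
      have d0: "d (zero_state V) = - (\<Sum>x\<in>free_states V. d x)"
        using d sum_states_zero_free[OF assms(1), of d] by simp
      have "mll_deriv V p (\<lambda>z. \<Sum>x\<in>free_states V. d x * coord_dir V x z) L M = mll_deriv V p d L M" for L M
        using assms(1) d0 by (intro mll_deriv_cong) (simp_all add: sum_coord_dir)
      then have free: "\<forall>x\<in>free_states V. d x = 0"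
        using lhs[rule_format, OF positive_dists_coords(1)[OF assms(1) p], of d] D
          positive_dists_coords(2)[OF assms(1) p] by simp
      then show "d x = 0" using x d0 by (cases "x = zero_state V") (auto simp: free_states_def)
    qed
  next
    assume nd: "nondegenerate V P"
    show ?lhs
    proof (intro ballI allI impI)
      fix q c x
      let ?d = "\<lambda>z. \<Sum>x\<in>free_states V. c x * coord_dir V x z"
      assume q: "q \<in> coords_domain V" and D: "\<forall>(L, M)\<in>P. mll_deriv V (dist_of_coords V q) ?d L M = 0"
        and x: "x \<in> free_states V"
      have "(\<Sum>z\<in>states V. ?d z) = - (\<Sum>x\<in>free_states V. c x) + (\<Sum>z\<in>free_states V. ?d z)"
        unfolding sum_states_zero_free[OF assms(1)]
        by (simp add: sum_coord_dir[OF assms(1) zero_state_in_states])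
      also have "(\<Sum>z\<in>free_states V. ?d z) = (\<Sum>x\<in>free_states V. c x)"
      proof (intro sum.cong refl)
        fix z assume "z \<in> free_states V"
        then have "z \<in> states V" "z \<noteq> zero_state V" by (auto simp: free_states_def)
        then show "?d z = c z" by (simp add: sum_coord_dir[OF assms(1)])
      qed
      finally have "(\<Sum>z\<in>states V. ?d z) = 0" by simp
      then have "?d x = 0"
        using nd q D x unfolding nondegenerate_def coords_domain_def free_states_def by blast
      moreover have "x \<in> states V" "x \<noteq> zero_state V" using x by (auto simp: free_states_def)
      ultimately show "c x = 0" by (simp add: sum_coord_dir[OF assms(1)])
    qed
  qed
  ultimately show ?thesis by simp
qed

section \<open>Continuity and smoothness\<close>

lemma continuous_map_real_compose:
  assumes "continuous_map X euclideanreal f" "continuous_on S g" "\<And>x. x \<in> topspace X \<Longrightarrow> f x \<in> S"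
  shows "continuous_map X euclideanreal (\<lambda>x. g (f x))"
proof -
  have "continuous_map X (top_of_set S) f"
    using assms by (auto simp: continuous_map_in_subtopology)
  moreover have "continuous_map (top_of_set S) euclideanreal g"
    using assms(2) by simp
  ultimately show ?thesis using continuous_map_compose unfolding o_def by blast
qed

text \<open>A partial derivative at \<open>x\<close> looks at the points \<open>x(i := t)\<close>.
  The first assumption keeps them in \<open>U\<close> for \<open>t\<close> near \<open>x i\<close>,
  so agreement on \<open>U\<close> passes to all partial derivatives.\<close>

lemma C_diff_cong:
  assumes "\<And>x i. x \<in> U \<Longrightarrow> i \<in> I \<Longrightarrow> eventually (\<lambda>t. x(i := t) \<in> U) (nhds (x i))"
    and "\<And>x. x \<in> U \<Longrightarrow> f x = g x"
  shows "C_diff k I U f \<longleftrightarrow> C_diff k I U g"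
  using assms(2)
proof (induction k arbitrary: f g)
  case 0
  then show ?case by (auto elim!: continuous_map_eq)
next
  case (Suc k)
  have ev: "eventually (\<lambda>t. f (x(i := t)) = g (x(i := t))) (nhds (x i))" if "x \<in> U" "i \<in> I" for x i
    using assms(1)[OF that] by (rule eventually_mono) (rule Suc.prems)
  have "partial_deriv i f x = partial_deriv i g x" if "x \<in> U" "i \<in> I" for x i
    unfolding partial_deriv_def using ev[OF that] by (rule deriv_cong_ev) simp
  then have "C_diff k I U (partial_deriv i f) \<longleftrightarrow> C_diff k I U (partial_deriv i g)" if "i \<in> I" for i
    using that by (intro Suc.IH) auto
  moreover have "(\<lambda>t. f (x(i := t))) field_differentiable at (x i) \<longleftrightarrow>
      (\<lambda>t. g (x(i := t))) field_differentiable at (x i)" if "x \<in> U" "i \<in> I" for x i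
    unfolding field_differentiable_def
    using DERIV_cong_ev[OF refl ev[OF that] refl] by simp
  moreover have "continuous_map (subtopology (powertop_real I) U) euclideanreal f \<longleftrightarrow>
      continuous_map (subtopology (powertop_real I) U) euclideanreal g"
    using Suc.prems by (auto elim!: continuous_map_eq)
  ultimately show ?case by simp
qed

text \<open>The shape of the sum is stable under differentiation: \<open>n\<close> goes up by one
  and \<open>c j\<close> is multiplied by the slope \<open>b j i\<close>. Hence the induction on
  \<open>k\<close> with \<open>n\<close> and \<open>c\<close> arbitrary.\<close>

lemma C_diff_sum_affine:
  fixes h :: "nat \<Rightarrow> real \<Rightarrow> real" and l :: "'j \<Rightarrow> ('i \<Rightarrow> real) \<Rightarrow> real"
  assumes "finite J"
    and U: "\<And>x i. x \<in> U \<Longrightarrow> i \<in> I \<Longrightarrow> eventually (\<lambda>t. x(i := t) \<in> U) (nhds (x i))"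
    and h: "\<And>n x. 0 < x \<Longrightarrow> (h n has_real_derivative h (Suc n) x) (at x)"
    and pos: "\<And>j x. j \<in> J \<Longrightarrow> x \<in> U \<Longrightarrow> 0 < l j x"
    and cont: "\<And>j. j \<in> J \<Longrightarrow> continuous_map (subtopology (powertop_real I) U) euclideanreal (l j)"
    and affine: "\<And>j x i t. j \<in> J \<Longrightarrow> i \<in> I \<Longrightarrow> l j (x(i := t)) = l j x + (t - x i) * b j i"
  shows "C_diff k I U (\<lambda>x. \<Sum>j\<in>J. c j * h n (l j x))"
proof (induction k arbitrary: n c)
  have hcont: "continuous_on {0<..} (h n)" for n
    using h by (meson DERIV_isCont continuous_at_imp_continuous_on greaterThan_iff)
  have "continuous_map (subtopology (powertop_real I) U) euclideanreal (\<lambda>x. c j * h n (l j x))"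
    if "j \<in> J" for j n c
    using that pos by (intro continuous_map_real_mult continuous_map_real_compose[OF cont hcont]) auto
  then have sum_cont: "continuous_map (subtopology (powertop_real I) U) euclideanreal
      (\<lambda>x. \<Sum>j\<in>J. c j * h n (l j x))" for n c
    using assms(1) by (intro continuous_map_sum)
  { case 0
    show ?case using sum_cont by simp }
  case (Suc k)
  have deriv: "((\<lambda>t. \<Sum>j\<in>J. c j * h n (l j (x(i := t)))) has_real_derivative
      (\<Sum>j\<in>J. (c j * b j i) * h (Suc n) (l j x))) (at (x i))" if "x \<in> U" "i \<in> I" for x i
  proof (rule DERIV_sum)
    fix j assume j: "j \<in> J"
    have "((\<lambda>t. h n (l j x + (t - x i) * b j i)) has_real_derivative h (Suc n) (l j x) * b j i) (at (x i))"
    proof (rule DERIV_chain2[where g = "\<lambda>t. l j x + (t - x i) * b j i"])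
      show "(h n has_real_derivative h (Suc n) (l j x)) (at (l j x + (x i - x i) * b j i))"
        using h[OF pos[OF j that(1)]] by simp
      show "((\<lambda>t. l j x + (t - x i) * b j i) has_real_derivative b j i) (at (x i))"
        by (auto intro!: derivative_eq_intros)
    qed
    then have "((\<lambda>t. c j * h n (l j x + (t - x i) * b j i)) has_real_derivative
        c j * (h (Suc n) (l j x) * b j i)) (at (x i))"
      by (rule DERIV_cmult)
    then show "((\<lambda>t. c j * h n (l j (x(i := t)))) has_real_derivative
        (c j * b j i) * h (Suc n) (l j x)) (at (x i))"
      by (simp add: affine[OF j that(2)] mult_ac)
  qed
  have "C_diff k I U (partial_deriv i (\<lambda>x. \<Sum>j\<in>J. c j * h n (l j x)))" if "i \<in> I" for i
  proof -
    have "partial_deriv i (\<lambda>x. \<Sum>j\<in>J. c j * h n (l j x)) x = (\<Sum>j\<in>J. (c j * b j i) * h (Suc n) (l j x))"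
      if "x \<in> U" for x
      unfolding partial_deriv_def using deriv[OF that \<open>i \<in> I\<close>] by (rule DERIV_imp_deriv)
    then show ?thesis
      by (subst C_diff_cong[OF U]) (auto intro!: Suc.IH)
  qed
  then show ?case
    using sum_cont deriv unfolding C_diff.simps field_differentiable_def by blast
qed

text \<open>The iterated derivatives of the logarithm on the positive reals in closed form; order
  \<open>Suc n\<close> carries the factor \<open>fact n\<close>, not
  \<open>fact (Suc n)\<close>.\<close>

primrec ln_deriv :: "nat \<Rightarrow> real \<Rightarrow> real" where
  "ln_deriv 0 x = ln x"
| "ln_deriv (Suc n) x = (-1) ^ n * fact n * inverse (x ^ Suc n)"

lemma has_real_derivative_ln_deriv:
  assumes "0 < x"
  shows "(ln_deriv n has_real_derivative ln_deriv (Suc n) x) (at x)"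
proof (cases n)
  case 0
  then show ?thesis using DERIV_ln[OF assms] by (simp add: fun_eq_iff[symmetric] ln_deriv.simps(1)[abs_def])
next
  case (Suc m)
  have "((\<lambda>x. (-1) ^ m * fact m * inverse (x ^ Suc m)) has_real_derivative
      (-1) ^ m * fact m * (- (real (Suc m) * x ^ m * inverse ((x ^ Suc m)\<^sup>2)))) (at x)"
    using assms DERIV_inverse'[OF DERIV_power[OF DERIV_ident, of "Suc m" x UNIV]]
    by (intro DERIV_cmult) (simp add: power2_eq_square mult_ac)
  also have "(-1) ^ m * fact m * (- (real (Suc m) * x ^ m * inverse ((x ^ Suc m)\<^sup>2))) = ln_deriv (Suc (Suc m)) x"
    using assms by (simp add: field_simps power2_eq_square)
  finally show ?thesis using Suc by (simp add: ln_deriv.simps(2)[abs_def])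
qed

lemma continuous_map_coord:
  "i \<in> I \<Longrightarrow> continuous_map (subtopology (powertop_real I) U) euclideanreal (\<lambda>x. x i)"
  by (intro continuous_map_from_subtopology continuous_map_product_projection)

text \<open>Stated for a family over any space, so that it applies both to the distributions
  themselves and to conditional distributions produced by an inverse map.\<close>

lemma continuous_map_mll_param:
  assumes "finite V" "M \<subseteq> V"
    and "\<And>x. x \<in> states V \<Longrightarrow> continuous_map X euclideanreal (\<lambda>z. p z x)"
    and "\<And>z x. z \<in> topspace X \<Longrightarrow> x \<in> states V \<Longrightarrow> 0 < p z x"
  shows "continuous_map X euclideanreal (\<lambda>z. mll_param V (p z) L M)"
proof -
  have "finite M" using assms finite_subset by blast
  moreover have "continuous_map X euclideanreal (\<lambda>z. marginal V (p z) M y)" for y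
    unfolding marginal_def using assms(1,3) by (intro continuous_map_sum) (auto simp: finite_states)
  moreover have "0 < marginal V (p z) M y" if "z \<in> topspace X" "y \<in> states M" for z y
    using that assms by (intro marginal_pos) auto
  ultimately show ?thesis
    unfolding mll_param_def
    by (intro continuous_map_real_divide continuous_map_sum continuous_map_real_mult
        continuous_map_real_compose[where S = "{0<..}" and g = ln] continuous_map_const[THEN iffD2])
      (auto simp: finite_states intro!: continuous_intros)
qed

lemma continuous_map_mll_vector:
  assumes "finite V" "effect_margin_pairs V P"
    and "\<And>x. x \<in> states V \<Longrightarrow> continuous_map X euclideanreal (\<lambda>z. p z x)"
    and "\<And>z x. z \<in> topspace X \<Longrightarrow> x \<in> states V \<Longrightarrow> 0 < p z x"
  shows "continuous_map X (powertop_real P) (\<lambda>z. mll_vector V P (p z))"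
  unfolding continuous_map_componentwise
  using assms(2)
  by (auto simp: mll_vector_def effect_margin_pairs_def intro!: continuous_map_mll_param assms)

text \<open>A parameter is a linear combination of logarithms of marginals, and marginals are
  positive and affine in the chart coordinates, with slopes the marginals of
  \<open>coord_dir\<close>.\<close>

lemma C_diff_mll_vector:
  assumes "finite V" "effect_margin_pairs V P" "j \<in> P"
  shows "C_diff k (free_states V) (coords_domain V) (\<lambda>q. mll_vector V P (dist_of_coords V q) j)"
proof -
  obtain L M where j: "j = (L, M)" by force
  then have M: "M \<subseteq> V" using assms by (auto simp: effect_margin_pairs_def)
  then have fM: "finite M" using assms(1) finite_subset by blast
  have fin: "finite (free_states V)" using finite_states[OF assms(1)] by (simp add: free_states_def)
  have cont: "continuous_map (subtopology (powertop_real (free_states V)) (coords_domain V)) euclideanreal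
      (\<lambda>q. marginal V (dist_of_coords V q) M y)" for y
    unfolding marginal_def
  proof (rule continuous_map_sum)
    fix x assume x: "x \<in> {x \<in> states V. restrict x M = y}"
    show "continuous_map (subtopology (powertop_real (free_states V)) (coords_domain V)) euclideanreal
        (\<lambda>q. dist_of_coords V q x)"
    proof (cases "x = zero_state V")
      case True
      then show ?thesis using x fin
        by (auto simp: dist_of_coords_def intro!: continuous_intros continuous_map_coord)
    next
      case False
      then show ?thesis using x
        by (auto simp: dist_of_coords_def free_states_def intro!: continuous_map_coord)
    qed
  qed (simp add: assms finite_states)
  have pos: "0 < marginal V (dist_of_coords V q) M y" if "y \<in> states M" "q \<in> coords_domain V" for y q
    using that assms(1) M by (intro marginal_pos) (auto simp: coords_domain_def dest: positive_distsD)
  have "C_diff k (free_states V) (coords_domain V) (\<lambda>q. \<Sum>y\<in>states M.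
      ((-1) ^ (\<Sum>v\<in>L. y v) / 2 ^ card M) * ln_deriv 0 (marginal V (dist_of_coords V q) M y))"
    using finite_states[OF fM] eventually_coords_domain[OF assms(1)] has_real_derivative_ln_deriv
      pos cont marginal_dist_of_coords_upd[OF assms(1)]
    by (rule C_diff_sum_affine[where l = "\<lambda>y q. marginal V (dist_of_coords V q) M y"
          and b = "\<lambda>y x. marginal V (coord_dir V x) M y" and h = ln_deriv
          and c = "\<lambda>y. (-1) ^ (\<Sum>v\<in>L. y v) / 2 ^ card M"])
  then show ?thesis
    using assms(3) by (simp add: j mll_vector_def mll_param_def sum_divide_distrib)
qed

text \<open>Completeness settles the count and differentiability always holds, so two conditions
  remain to be transferred between \<open>V\<close> and \<open>V - {v}\<close>.\<close>

lemma smooth_parameterization_mll_vector_iff: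
  assumes "finite V" "complete_pairs V P"
  shows "smooth_parameterization V P (mll_vector V P) \<longleftrightarrow>
    (\<exists>\<Theta>. openin (powertop_real P) \<Theta> \<and>
      homeomorphic_map (subtopology (powertop_real (states V)) (positive_dists V))
        (subtopology (powertop_real P) \<Theta>) (mll_vector V P)) \<and> nondegenerate V P"
proof -
  have emp: "effect_margin_pairs V P" using assms(2) by (simp add: complete_pairs_def)
  show ?thesis
    unfolding smooth_parameterization_def full_rank_iff_nondegenerate[OF assms(1) emp]
    using complete_pairs_card[OF assms] C_diff_mll_vector[OF assms(1) emp] by blast
qed

section \<open>Splitting along a vertex\<close>

text \<open>The homogeneous version that slices call for. All effects being non-empty, the direction
  \<open>p\<close> has zero derivative; subtracting a multiple of it brings the total of
  \<open>d\<close> to zero without changing the derivatives.\<close>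

lemma nondegenerate_proportional:
  assumes "finite V" "effect_margin_pairs V P" "nondegenerate V P"
    and p: "\<And>x. x \<in> states V \<Longrightarrow> 0 < p x"
    and d: "\<And>L M. (L, M) \<in> P \<Longrightarrow> mll_deriv V p d L M = 0"
  obtains k where "\<And>x. x \<in> states V \<Longrightarrow> d x = k * p x"
proof -
  define a where "a = (\<Sum>x\<in>states V. p x)"
  \<comment> \<open>The factor for which \<open>k * p\<close> has the same total as
    \<open>d\<close>.\<close>
  define k where "k = (\<Sum>x\<in>states V. d x) / a"
  let ?q = "restrict (\<lambda>x. (1 / a) * p x) (states V)" and ?d = "\<lambda>x. d x + (- k) * p x"
  have a: "0 < a"
    unfolding a_def using p finite_states[OF assms(1)] states_nonempty by (intro sum_pos)
  have "?q \<in> positive_dists V"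
    using a p by (intro positive_distsI) (auto simp: a_def simp flip: sum_divide_distrib)
  moreover have "(\<Sum>x\<in>states V. ?d x) = 0"
    unfolding sum.distrib sum_distrib_left[symmetric] a_def[symmetric] using a by (simp add: k_def)
  moreover have "mll_deriv V ?q ?d L M = 0" if LM: "(L, M) \<in> P" for L M
  proof -
    have L: "M \<subseteq> V" "L \<subseteq> M" "L \<noteq> {}" using assms(2) LM by (auto simp: effect_margin_pairs_def)
    have "mll_deriv V ?q ?d L M = mll_deriv V (\<lambda>x. (1 / a) * p x) ?d L M"
      by (rule mll_deriv_cong) auto
    also have "\<dots> = 0"
      unfolding mll_deriv_base_cmult mll_deriv_add mll_deriv_cmult
      using d[OF LM] mll_deriv_self[OF assms(1) L(1,2) p] L(3) by simp
    finally show ?thesis .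
  qed
  ultimately have "\<forall>x\<in>states V. ?d x = 0"
    using assms(3) unfolding nondegenerate_def by blast
  then show thesis by (intro that[of k]) auto
qed

text \<open>Inverse of the logit \<open>ln a - ln (1 - a)\<close>; it turns an arbitrary real
  log-odds into a weight strictly between 0 and 1.\<close>

definition logistic :: "real \<Rightarrow> real" where
  "logistic s = inverse (1 + exp (- s))"

lemma logistic_bounds: "0 < logistic s" "logistic s < 1"
  by (simp_all add: logistic_def add_pos_pos inverse_less_1_iff)

lemma logit_logistic: "ln (logistic s) - ln (1 - logistic s) = s"
proof -
  have "1 + exp (- s) > 0" by (simp add: add_pos_pos)
  then have "1 - logistic s = exp (- s) * logistic s"
    by (simp add: logistic_def field_simps)
  then show ?thesis using logistic_bounds(1)[of s] by (simp add: ln_mult_pos)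
qed

lemma logistic_logit: "0 < a \<Longrightarrow> a < 1 \<Longrightarrow> logistic (ln a - ln (1 - a)) = a"
  by (simp add: logistic_def exp_diff field_simps)

lemma continuous_on_logistic: "continuous_on UNIV logistic"
proof -
  have "1 + exp (- s) \<noteq> 0" for s :: real by (metis add_pos_pos exp_gt_zero less_numeral_extra(1,3))
  then show ?thesis unfolding logistic_def by (intro continuous_intros) auto
qed

section \<open>The topology on positive distributions\<close>

abbreviation dist_topology :: "'a set \<Rightarrow> (('a \<Rightarrow> nat) \<Rightarrow> real) topology" where
  "dist_topology V \<equiv> subtopology (powertop_real (states V)) (positive_dists V)"

lemma topspace_dist_topology: "topspace (dist_topology V) = positive_dists V"
  by (auto simp: positive_dists_def)

lemma continuous_map_into_dist_topology:
  assumes "\<And>x. x \<in> states V \<Longrightarrow> continuous_map Z euclideanreal (\<lambda>z. f z x)"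
    and "\<And>z. z \<in> topspace Z \<Longrightarrow> f z \<in> positive_dists V"
  shows "continuous_map Z (dist_topology V) f"
  using assms positive_distsD(3)
  by (auto simp: continuous_map_in_subtopology continuous_map_componentwise)

lemma continuous_map_component:
  assumes "continuous_map Z (powertop_real I) f" "i \<in> I"
  shows "continuous_map Z euclideanreal (\<lambda>z. f z i)"
  using assms by (simp add: continuous_map_componentwise)

lemma continuous_map_dist_component:
  assumes "continuous_map Z (dist_topology V) f" "x \<in> states V"
  shows "continuous_map Z euclideanreal (\<lambda>z. f z x)"
  using continuous_map_component[OF _ assms(2)] assms(1) unfolding continuous_map_in_subtopology by blast

lemma continuous_map_mll_vector_dist:
  assumes "finite V" "effect_margin_pairs V P"
  shows "continuous_map (dist_topology V) (powertop_real P) (mll_vector V P)"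
  using assms continuous_map_dist_component[OF continuous_map_id[unfolded id_def]] positive_distsD(1)
  by (intro continuous_map_mll_vector) (auto simp: topspace_dist_topology)

section \<open>Joint distributions as a weight and two conditional distributions\<close>

definition slice_mass :: "'a set \<Rightarrow> 'a \<Rightarrow> (('a \<Rightarrow> nat) \<Rightarrow> real) \<Rightarrow> nat \<Rightarrow> real" where
  "slice_mass V v p i = (\<Sum>x\<in>states (V - {v}). p (x(v := i)))"

definition cond_dist :: "'a set \<Rightarrow> 'a \<Rightarrow> (('a \<Rightarrow> nat) \<Rightarrow> real) \<Rightarrow> nat \<Rightarrow> ('a \<Rightarrow> nat) \<Rightarrow> real" where
  "cond_dist V v p i = (\<lambda>x\<in>states (V - {v}). p (x(v := i)) / slice_mass V v p i)"

text \<open>The joint law with \<open>P(X_v = 0) = a\<close> and conditional laws \<open>q0\<close>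
  and \<open>q1\<close> given \<open>X_v = 0\<close> and \<open>X_v = 1\<close>.\<close>

definition mixture ::
    "'a set \<Rightarrow> 'a \<Rightarrow> real \<Rightarrow> (('a \<Rightarrow> nat) \<Rightarrow> real) \<Rightarrow> (('a \<Rightarrow> nat) \<Rightarrow> real) \<Rightarrow> ('a \<Rightarrow> nat) \<Rightarrow> real" where
  "mixture V v a q0 q1 = (\<lambda>x\<in>states V.
     if x v = 0 then a * q0 (restrict x (V - {v})) else (1 - a) * q1 (restrict x (V - {v})))"

lemma restrict_state: "x \<in> states V \<Longrightarrow> restrict x V = x"
  by (simp add: states_def PiE_restrict)

lemma state_cases:
  assumes "v \<in> V" "x \<in> states V"
  obtains y i where "y \<in> states (V - {v})" "i \<in> {0, 1}" "x = y(v := i)"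
proof
  show "restrict x (V - {v}) \<in> states (V - {v})" "x v \<in> {0, 1}"
    using assms by (fastforce simp: states_def PiE_iff)+
  show "x = (restrict x (V - {v}))(v := x v)"
    using assms by (auto simp: states_def PiE_iff extensional_def)
qed

lemma mixture_upd:
  assumes "v \<in> V" "x \<in> states (V - {v})"
  shows "mixture V v a q0 q1 (x(v := 0)) = a * q0 x"
    and "mixture V v a q0 q1 (x(v := 1)) = (1 - a) * q1 x"
  using assms upd_in_states[OF assms(2,1)]
  by (simp_all add: mixture_def restrict_state)

lemma
  assumes "v \<in> V" "q0 \<in> positive_dists (V - {v})" "q1 \<in> positive_dists (V - {v})" "0 < a" "a < 1"
  shows mixture_in_positive_dists: "mixture V v a q0 q1 \<in> positive_dists V"
    and cond_dist_mixture: "cond_dist V v (mixture V v a q0 q1) 0 = q0"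
      "cond_dist V v (mixture V v a q0 q1) 1 = q1"
proof -
  note q0 = positive_distsD[OF assms(2)] and q1 = positive_distsD[OF assms(3)]
  have m: "slice_mass V v (mixture V v a q0 q1) 0 = a" "slice_mass V v (mixture V v a q0 q1) 1 = 1 - a"
    using q0(2) q1(2)
    by (simp_all add: slice_mass_def mixture_upd[OF assms(1)] del: One_nat_def flip: sum_distrib_left cong: sum.cong)
  show "cond_dist V v (mixture V v a q0 q1) 0 = q0" "cond_dist V v (mixture V v a q0 q1) 1 = q1"
    using q0(3) q1(3) assms(4,5) unfolding cond_dist_def m
    by (auto simp: fun_eq_iff mixture_upd[OF assms(1)] extensional_def simp del: One_nat_def)
  show "mixture V v a q0 q1 \<in> positive_dists V"
  proof (rule positive_distsI)
    fix x assume "x \<in> states V"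
    then obtain y i where y: "y \<in> states (V - {v})" "i \<in> {0, 1}" "x = y(v := i)"
      by (rule state_cases[OF assms(1)])
    then show "0 < mixture V v a q0 q1 x"
      using mixture_upd[OF assms(1) y(1)] q0(1) q1(1) assms(4,5) by (auto simp del: One_nat_def)
  next
    show "(\<Sum>x\<in>states V. mixture V v a q0 q1 x) = 1"
      unfolding sum_states_split[OF assms(1)] using m by (simp add: slice_mass_def)
  qed (simp add: mixture_def)
qed

text \<open>With the preceding lemma, positive laws on \<open>V\<close> correspond to a weight in
  the open unit interval and two positive laws on \<open>V - {v}\<close>.\<close>

lemma
  assumes "finite V" "v \<in> V" "p \<in> positive_dists V"
  shows slice_mass_pos: "i \<in> {0, 1} \<Longrightarrow> 0 < slice_mass V v p i"
    and slice_mass_1: "slice_mass V v p 1 = 1 - slice_mass V v p 0"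
    and cond_dist_in_positive_dists: "i \<in> {0, 1} \<Longrightarrow> cond_dist V v p i \<in> positive_dists (V - {v})"
    and mixture_cond_dist:
      "mixture V v (slice_mass V v p 0) (cond_dist V v p 0) (cond_dist V v p 1) = p"
proof -
  note p = positive_distsD[OF assms(3)]
  note up = p(1)[OF upd_in_states[OF _ assms(2)]]
  show pos: "0 < slice_mass V v p i" if "i \<in> {0, 1}" for i
    unfolding slice_mass_def using up that finite_states states_nonempty assms(1)
    by (intro sum_pos) auto
  show sum: "slice_mass V v p 1 = 1 - slice_mass V v p 0"
    using p(2) unfolding sum_states_split[OF assms(2)] slice_mass_def by simp
  show "cond_dist V v p i \<in> positive_dists (V - {v})" if "i \<in> {0, 1}" for i
  proof (rule positive_distsI)
    show "(\<Sum>x\<in>states (V - {v}). cond_dist V v p i x) = 1"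
      using pos[OF that] by (simp add: cond_dist_def slice_mass_def flip: sum_divide_distrib)
  qed (use pos[OF that] up[OF _ that] in \<open>auto simp: cond_dist_def\<close>)
  show "mixture V v (slice_mass V v p 0) (cond_dist V v p 0) (cond_dist V v p 1) = p"
  proof
    fix x
    show "mixture V v (slice_mass V v p 0) (cond_dist V v p 0) (cond_dist V v p 1) x = p x"
    proof (cases "x \<in> states V")
      case True
      then obtain y i where y: "y \<in> states (V - {v})" "i \<in> {0, 1}" "x = y(v := i)"
        by (rule state_cases[OF assms(2)])
      then show ?thesis
        using mixture_upd[OF assms(2) y(1)] pos[of 0] pos[of 1] sum
        by (auto simp: cond_dist_def simp del: One_nat_def)
    next
      case False
      then show ?thesis using p(3) by (simp add: mixture_def extensional_def)
    qed
  qed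
qed

lemma continuous_map_cond_dist:
  assumes "finite V" "v \<in> V" "i \<in> {0, 1}"
  shows "continuous_map (dist_topology V) (dist_topology (V - {v})) (\<lambda>p. cond_dist V v p i)"
proof (rule continuous_map_into_dist_topology)
  have c: "continuous_map (dist_topology V) euclideanreal (\<lambda>p. p (x(v := i)))"
    if "x \<in> states (V - {v})" for x
    using continuous_map_dist_component[OF continuous_map_id[unfolded id_def] upd_in_states[OF that assms(2,3)]] .
  fix x assume x: "x \<in> states (V - {v})"
  have "continuous_map (dist_topology V) euclideanreal (\<lambda>p. p (x(v := i)) / slice_mass V v p i)"
  proof (rule continuous_map_real_divide)
    show "continuous_map (dist_topology V) euclideanreal (\<lambda>p. slice_mass V v p i)"
      unfolding slice_mass_def using c finite_states[of "V - {v}"] assms(1) by (intro continuous_map_sum) auto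
    fix p assume "p \<in> topspace (dist_topology V)"
    then have "p \<in> positive_dists V" using topspace_dist_topology by blast
    then show "slice_mass V v p i \<noteq> 0" using slice_mass_pos[OF assms(1,2) _ assms(3)] by force
  qed (rule c[OF x])
  then show "continuous_map (dist_topology V) euclideanreal (\<lambda>p. cond_dist V v p i x)"
    using x by (simp add: cond_dist_def)
next
  fix p assume "p \<in> topspace (dist_topology V)"
  then have "p \<in> positive_dists V" using topspace_dist_topology by blast
  then show "cond_dist V v p i \<in> positive_dists (V - {v})"
    using cond_dist_in_positive_dists[OF assms(1,2) _ assms(3)] by blast
qed

lemma continuous_map_mixture:
  assumes "v \<in> V" "continuous_map Z euclideanreal a"
    and "continuous_map Z (dist_topology (V - {v})) q0" "continuous_map Z (dist_topology (V - {v})) q1"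
    and "\<And>z. z \<in> topspace Z \<Longrightarrow> 0 < a z \<and> a z < 1"
  shows "continuous_map Z (dist_topology V) (\<lambda>z. mixture V v (a z) (q0 z) (q1 z))"
proof (rule continuous_map_into_dist_topology)
  fix x assume x: "x \<in> states V"
  then have r: "restrict x (V - {v}) \<in> states (V - {v})" by (fastforce simp: states_def PiE_iff)
  show "continuous_map Z euclideanreal (\<lambda>z. mixture V v (a z) (q0 z) (q1 z) x)"
    using x assms(2) continuous_map_dist_component[OF assms(3) r] continuous_map_dist_component[OF assms(4) r]
    by (cases "x v = 0") (auto simp: mixture_def intro!: continuous_intros)
next
  fix z assume z: "z \<in> topspace Z"
  then have "q0 z \<in> positive_dists (V - {v})" "q1 z \<in> positive_dists (V - {v})"
    using assms(3,4) by (auto simp: continuous_map_in_subtopology)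
  then show "mixture V v (a z) (q0 z) (q1 z) \<in> positive_dists V"
    using assms(5)[OF z] by (intro mixture_in_positive_dists[OF assms(1)]) auto
qed

section \<open>Structure of the collection under the shared-margin hypothesis\<close>

locale vertex_split =
  fixes V :: "'a set" and P :: "('a set \<times> 'a set) set" and v :: 'a
  assumes finite_V: "finite V"
    and complete: "complete_pairs V P"
    and v: "v \<in> V"
    and same_margin: "\<And>A. A \<noteq> {} \<Longrightarrow> A \<subseteq> V - {v} \<Longrightarrow> within_same_margin P (A \<union> {v}) A"
begin

declare One_nat_def [simp del]

abbreviation "W \<equiv> V - {v}"
abbreviation "Q \<equiv> remove_vertex v P"

lemma pairs: "effect_margin_pairs V P"
  using complete by (simp add: complete_pairs_def)

lemma pairD: "(L, M) \<in> P \<Longrightarrow> L \<noteq> {} \<and> L \<subseteq> M \<and> M \<subseteq> V"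
  using pairs by (auto simp: effect_margin_pairs_def)

lemma ex1_margin: "L \<noteq> {} \<Longrightarrow> L \<subseteq> V \<Longrightarrow> \<exists>!M. (L, M) \<in> P"
  using complete by (simp add: complete_pairs_def)

lemma margin_unique: "(L, M) \<in> P \<Longrightarrow> (L, M') \<in> P \<Longrightarrow> M = M'"
  using ex1_margin pairD by (metis subset_trans)

text \<open>The hypothesis supplies some common margin; completeness gives each effect only one, so
  it is \<open>M\<close>, and it contains \<open>v\<close> because it contains the larger
  effect.\<close>

lemma insert_pair:
  assumes "(A, M) \<in> P" "v \<notin> A"
  shows "(insert v A, M) \<in> P" and "v \<in> M"
proof -
  have "A \<noteq> {}" "A \<subseteq> W" using pairD[OF assms(1)] assms(2) by auto
  then obtain M' where "(A \<union> {v}, M') \<in> P" "(A, M') \<in> P"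
    using same_margin[of A] unfolding within_same_margin_def by blast
  then show "(insert v A, M) \<in> P" using margin_unique[OF assms(1)] by auto
  then show "v \<in> M" using pairD[of "insert v A" M] by simp
qed

lemma remove_pair:
  assumes "(L, M) \<in> P" "v \<in> L" "L \<noteq> {v}"
  shows "(L - {v}, M) \<in> P"
proof -
  have "L - {v} \<noteq> {}" "L - {v} \<subseteq> W" using pairD[OF assms(1)] assms(2,3) by auto
  then obtain M' where M': "((L - {v}) \<union> {v}, M') \<in> P" "(L - {v}, M') \<in> P"
    using same_margin[of "L - {v}"] unfolding within_same_margin_def by blast
  moreover have "(L - {v}) \<union> {v} = L" using assms(2) by auto
  ultimately show ?thesis using margin_unique[OF assms(1)] by auto
qed

text \<open>The margin of \<open>{v}\<close>, about which the hypothesis says nothing, as the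
  partner would be the empty effect.\<close>

definition N :: "'a set" where "N = (THE M. ({v}, M) \<in> P)"

lemma N: "({v}, N) \<in> P"
  unfolding N_def by (rule theI', rule ex1_margin) (use v in auto)

lemma v_in_margin: "(L, M) \<in> P \<Longrightarrow> v \<in> M"
  using insert_pair(2)[of L M] pairD[of L M] by blast

text \<open>As every margin contains \<open>v\<close>, deleting \<open>v\<close> from it is undone
  by \<open>insert v\<close>.\<close>

lemma Q_iff: "(A, M) \<in> Q \<longleftrightarrow> v \<notin> A \<and> v \<notin> M \<and> (A, insert v M) \<in> P"
proof
  assume "(A, M) \<in> Q"
  then obtain M' where M': "(A, M') \<in> P" "v \<notin> A" "M = M' - {v}"
    by (auto simp: remove_vertex_def)
  then show "v \<notin> A \<and> v \<notin> M \<and> (A, insert v M) \<in> P"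
    using v_in_margin by (auto simp: insert_absorb)
next
  assume "v \<notin> A \<and> v \<notin> M \<and> (A, insert v M) \<in> P"
  then show "(A, M) \<in> Q"
    unfolding remove_vertex_def by (intro CollectI exI[of _ A] exI[of _ "insert v M"]) auto
qed

lemma in_Q: "(A, M) \<in> P \<Longrightarrow> v \<notin> A \<Longrightarrow> (A, M - {v}) \<in> Q"
  using v_in_margin by (simp add: Q_iff insert_absorb)

lemma Q_pairD: "(A, M) \<in> Q \<Longrightarrow> A \<noteq> {} \<and> A \<subseteq> M \<and> M \<subseteq> W"
  using pairD[of A "insert v M"] unfolding Q_iff by auto

lemma Q_pairs: "effect_margin_pairs W Q"
  using Q_pairD by (auto simp: effect_margin_pairs_def)

lemma complete_Q: "complete_pairs W Q"
  unfolding complete_pairs_def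
proof (intro conjI allI impI Q_pairs)
  fix A assume A: "A \<noteq> {} \<and> A \<subseteq> W"
  then obtain M where M: "(A, M) \<in> P" using ex1_margin[of A] by blast
  show "\<exists>!M. (A, M) \<in> Q"
  proof
    show "(A, M - {v}) \<in> Q" using A M by (intro in_Q) auto
    fix M' assume M': "(A, M') \<in> Q"
    then have "insert v M' = M" using margin_unique[OF M, of "insert v M'"] by (simp add: Q_iff)
    then show "M' = M - {v}" using M' Q_iff by auto
  qed
qed

text \<open>Thus \<open>P\<close> is the pair \<open>({v}, N)\<close> and two pairs for each element
  of \<open>Q\<close>, so a vector over \<open>P\<close> amounts to a real number and two vectors
  over \<open>Q\<close>.\<close>

lemma pair_cases [consumes 1, case_names vertex without "with"]:
  assumes "(L, M) \<in> P"
  obtains "L = {v}" "M = N"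
  | "v \<notin> L" "v \<in> M" "(L, M - {v}) \<in> Q"
  | A where "L = insert v A" "L \<noteq> {v}" "v \<notin> A" "v \<in> M" "(A, M) \<in> P" "(A, M - {v}) \<in> Q"
proof -
  consider "L = {v}" | "v \<notin> L" | "v \<in> L" "L \<noteq> {v}" by blast
  then show thesis
  proof cases
    case 1
    then show thesis using that(1) margin_unique[OF N] assms by auto
  next
    case 2
    then show thesis using that(2) in_Q v_in_margin assms by auto
  next
    case 3
    then show thesis using that(3)[of "L - {v}"] remove_pair[OF assms] in_Q[of "L - {v}" M] v_in_margin assms
      by (auto simp: insert_absorb)
  qed
qed

text \<open>
  Sums and differences of the parameters of \<open>A\<close> and \<open>A \<union> {v}\<close> are the parameters of the two
  conditional distributions given \<open>X\<^sub>v\<close>; \<open>slice_params\<close> and \<open>join_params\<close> are this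
  change of coordinates and its inverse.
\<close>

definition slice_params :: "nat \<Rightarrow> ('a set \<times> 'a set \<Rightarrow> real) \<Rightarrow> 'a set \<times> 'a set \<Rightarrow> real" where
  "slice_params i \<xi> = (\<lambda>(A, M)\<in>Q. \<xi> (A, insert v M) + (-1) ^ i * \<xi> (insert v A, insert v M))"

definition join_params ::
    "real \<Rightarrow> ('a set \<times> 'a set \<Rightarrow> real) \<Rightarrow> ('a set \<times> 'a set \<Rightarrow> real) \<Rightarrow> 'a set \<times> 'a set \<Rightarrow> real" where
  "join_params t \<eta>0 \<eta>1 = (\<lambda>(L, M)\<in>P.
     if L = {v} then t
     else if v \<in> L then (\<eta>0 (L - {v}, M - {v}) - \<eta>1 (L - {v}, M - {v})) / 2
     else (\<eta>0 (L, M - {v}) + \<eta>1 (L, M - {v})) / 2)"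

lemma
  shows join_params_vertex: "join_params t \<eta>0 \<eta>1 ({v}, N) = t"
    and join_params_without: "(A, M) \<in> P \<Longrightarrow> v \<notin> A \<Longrightarrow>
      join_params t \<eta>0 \<eta>1 (A, M) = (\<eta>0 (A, M - {v}) + \<eta>1 (A, M - {v})) / 2"
    and join_params_with: "(A, M) \<in> P \<Longrightarrow> v \<notin> A \<Longrightarrow>
      join_params t \<eta>0 \<eta>1 (insert v A, M) = (\<eta>0 (A, M - {v}) - \<eta>1 (A, M - {v})) / 2"
  using N insert_pair pairD[of A M] by (auto simp: join_params_def)

lemma slice_join_params:
  assumes "\<eta>0 \<in> extensional Q" "\<eta>1 \<in> extensional Q"
  shows "slice_params 0 (join_params t \<eta>0 \<eta>1) = \<eta>0" "slice_params 1 (join_params t \<eta>0 \<eta>1) = \<eta>1"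
proof -
  have "slice_params 0 (join_params t \<eta>0 \<eta>1) (A, M) = \<eta>0 (A, M) \<and>
      slice_params 1 (join_params t \<eta>0 \<eta>1) (A, M) = \<eta>1 (A, M)" for A M
    using assms by (cases "(A, M) \<in> Q")
      (auto simp: slice_params_def Q_iff join_params_without join_params_with extensional_def field_simps)
  then show "slice_params 0 (join_params t \<eta>0 \<eta>1) = \<eta>0" "slice_params 1 (join_params t \<eta>0 \<eta>1) = \<eta>1"
    by (auto simp: fun_eq_iff)
qed

lemma join_slice_params:
  assumes "\<xi> \<in> extensional P"
  shows "join_params (\<xi> ({v}, N)) (slice_params 0 \<xi>) (slice_params 1 \<xi>) = \<xi>"
proof (intro ext)
  fix j :: "'a set \<times> 'a set"
  obtain L M where j: "j = (L, M)" by force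
  show "join_params (\<xi> ({v}, N)) (slice_params 0 \<xi>) (slice_params 1 \<xi>) j = \<xi> j"
  proof (cases "(L, M) \<in> P")
    case True
    then show ?thesis
    proof (cases rule: pair_cases)
      case vertex
      then show ?thesis by (simp add: j join_params_vertex)
    next
      case without
      then show ?thesis using True
        by (simp add: j join_params_without slice_params_def insert_absorb)
    next
      case ("with" A)
      then show ?thesis
        by (simp add: j join_params_with slice_params_def insert_absorb)
    qed
  next
    case False
    then show ?thesis using assms by (simp add: j join_params_def extensional_def)
  qed
qed

lemma join_params_extensional: "join_params t \<eta>0 \<eta>1 \<in> extensional P"
  by (simp add: join_params_def)

text \<open>The mean of the log marginals over the margin \<open>N - {v}\<close>, that is, the
  parameter of the empty effect left by \<open>{v}\<close>.\<close>

abbreviation "\<mu> q \<equiv> mll_param W q {} (N - {v})"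

lemma mll_vector_extensional: "mll_vector U R p \<in> extensional R"
  by (simp add: mll_vector_def)

text \<open>The triangular form: the weights \<open>a\<close> and \<open>1 - a\<close> only scale
  the slices, so they disappear from every coordinate but \<open>{v}\<close>, which is half the
  difference of the two empty-effect parameters.\<close>

lemma mll_vector_mixture:
  assumes "q0 \<in> positive_dists W" "q1 \<in> positive_dists W" "0 < a" "a < 1"
  shows "mll_vector V P (mixture V v a q0 q1) =
    join_params ((ln a - ln (1 - a) + \<mu> q0 - \<mu> q1) / 2) (mll_vector W Q q0) (mll_vector W Q q1)"
proof (intro ext)
  fix j :: "'a set \<times> 'a set"
  obtain L M where j: "j = (L, M)" by force
  let ?p = "mixture V v a q0 q1"
  have slice0: "mll_param W (\<lambda>x. ?p (x(v := 0))) A M' = (if A = {} then ln a else 0) + mll_param W q0 A M'"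
    if "M' \<subseteq> W" "A \<subseteq> M'" for A M'
  proof -
    have "mll_param W (\<lambda>x. ?p (x(v := 0))) A M' = mll_param W (\<lambda>x. a * q0 x) A M'"
      by (rule mll_param_cong) (rule mixture_upd(1)[OF v])
    then show ?thesis using mll_param_scale[OF _ that positive_distsD(1)[OF assms(1)] assms(3)] finite_V by simp
  qed
  have slice1: "mll_param W (\<lambda>x. ?p (x(v := 1))) A M' = (if A = {} then ln (1 - a) else 0) + mll_param W q1 A M'"
    if "M' \<subseteq> W" "A \<subseteq> M'" for A M'
  proof -
    have "mll_param W (\<lambda>x. ?p (x(v := 1))) A M' = mll_param W (\<lambda>x. (1 - a) * q1 x) A M'"
      by (rule mll_param_cong) (rule mixture_upd(2)[OF v])
    then show ?thesis using mll_param_scale[OF _ that positive_distsD(1)[OF assms(2)], where c = "1 - a"] assms(4) finite_V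
      by simp
  qed
  show "mll_vector V P ?p j =
    join_params ((ln a - ln (1 - a) + \<mu> q0 - \<mu> q1) / 2) (mll_vector W Q q0) (mll_vector W Q q1) j"
  proof (cases "(L, M) \<in> P")
    case True
    then have M: "M \<subseteq> V" "M - {v} \<subseteq> W" "v \<in> M" "L \<subseteq> M" using pairD[OF True] v_in_margin[OF True] by auto
    note split = mll_param_split[OF finite_V M(3,1)] mll_param_split_insert[OF finite_V M(3,1)]
    from True show ?thesis
    proof (cases rule: pair_cases)
      \<comment> \<open>Here the effect is \<open>insert v {}\<close>, so the scaling terms
        \<open>ln a\<close> and \<open>ln (1 - a)\<close> survive.\<close>
      case vertex
      then show ?thesis
        using True M split(2)[of "{}"] slice0[OF M(2)] slice1[OF M(2)]
        by (simp add: j mll_vector_def join_params_vertex)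
    next
      case without
      then have L: "L \<subseteq> M - {v}" "L \<noteq> {}" using M pairD[OF True] by auto
      then show ?thesis using True without split(1)[OF L(1)] slice0[OF M(2) L(1)] slice1[OF M(2) L(1)]
        by (simp add: j mll_vector_def join_params_without)
    next
      case ("with" A)
      then have A: "A \<subseteq> M - {v}" "A \<noteq> {}" using M by auto
      then show ?thesis using True "with" split(2)[OF A(1)] slice0[OF M(2) A(1)] slice1[OF M(2) A(1)]
        by (simp add: j mll_vector_def join_params_with)
    qed
  next
    case False
    then show ?thesis by (simp add: j mll_vector_def join_params_def)
  qed
qed

text \<open>Every \<open>p\<close> is the mixture of its own conditional laws, so
  \<open>mll_vector_mixture\<close> applies to it and can be read off slice by slice.\<close>

lemma slice_params_mll_vector:
  assumes "p \<in> positive_dists V"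
  shows "slice_params 0 (mll_vector V P p) = mll_vector W Q (cond_dist V v p 0)"
    and "slice_params 1 (mll_vector V P p) = mll_vector W Q (cond_dist V v p 1)"
    and "mll_vector V P p ({v}, N) = (ln (slice_mass V v p 0) - ln (1 - slice_mass V v p 0) +
      \<mu> (cond_dist V v p 0) - \<mu> (cond_dist V v p 1)) / 2"
proof -
  note c = cond_dist_in_positive_dists[OF finite_V v assms] slice_mass_pos[OF finite_V v assms]
    slice_mass_1[OF finite_V v assms]
  have "mll_vector V P p = join_params ((ln (slice_mass V v p 0) - ln (1 - slice_mass V v p 0) +
      \<mu> (cond_dist V v p 0) - \<mu> (cond_dist V v p 1)) / 2)
      (mll_vector W Q (cond_dist V v p 0)) (mll_vector W Q (cond_dist V v p 1))"
    using mll_vector_mixture[OF c(1)[of 0] c(1)[of 1], of "slice_mass V v p 0"] c(2)[of 0] c(2)[of 1] c(3)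
      mixture_cond_dist[OF finite_V v assms] by simp
  then show "slice_params 0 (mll_vector V P p) = mll_vector W Q (cond_dist V v p 0)"
    "slice_params 1 (mll_vector V P p) = mll_vector W Q (cond_dist V v p 1)"
    "mll_vector V P p ({v}, N) = (ln (slice_mass V v p 0) - ln (1 - slice_mass V v p 0) +
      \<mu> (cond_dist V v p 0) - \<mu> (cond_dist V v p 1)) / 2"
    using slice_join_params[OF mll_vector_extensional mll_vector_extensional] join_params_vertex by simp_all
qed

text \<open>The weight \<open>P(X\<^sub>v = 0)\<close> that the parameter of \<open>{v}\<close> forces on given conditional distributions.\<close>

definition weight :: "real \<Rightarrow> (('a \<Rightarrow> nat) \<Rightarrow> real) \<Rightarrow> (('a \<Rightarrow> nat) \<Rightarrow> real) \<Rightarrow> real" where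
  "weight t q0 q1 = logistic (2 * t - \<mu> q0 + \<mu> q1)"

lemma weight_bounds: "0 < weight t q0 q1" "weight t q0 q1 < 1"
  by (simp_all add: weight_def logistic_bounds)

text \<open>The value at \<open>{v}\<close> can be prescribed freely: its equation is solved for the
  log-odds once \<open>q0\<close> and \<open>q1\<close> are fixed.\<close>

lemma mll_vector_mixture_weight:
  assumes "q0 \<in> positive_dists W" "q1 \<in> positive_dists W"
  shows "mll_vector V P (mixture V v (weight t q0 q1) q0 q1) =
    join_params t (mll_vector W Q q0) (mll_vector W Q q1)"
  using mll_vector_mixture[OF assms weight_bounds, of t] by (simp add: weight_def logit_logistic)

lemma mixture_weight_cond_dist:
  assumes "p \<in> positive_dists V"
  shows "mixture V v (weight (mll_vector V P p ({v}, N)) (cond_dist V v p 0) (cond_dist V v p 1))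
    (cond_dist V v p 0) (cond_dist V v p 1) = p"
proof -
  have "2 * mll_vector V P p ({v}, N) - \<mu> (cond_dist V v p 0) + \<mu> (cond_dist V v p 1) =
      ln (slice_mass V v p 0) - ln (1 - slice_mass V v p 0)"
    unfolding slice_params_mll_vector(3)[OF assms] by (simp add: field_simps)
  then have "weight (mll_vector V P p ({v}, N)) (cond_dist V v p 0) (cond_dist V v p 1) = slice_mass V v p 0"
    using slice_mass_pos[OF finite_V v assms, of 0] slice_mass_pos[OF finite_V v assms, of 1]
      slice_mass_1[OF finite_V v assms]
    by (simp add: weight_def logistic_logit)
  then show ?thesis using mixture_cond_dist[OF finite_V v assms] by simp
qed

section \<open>Transfer of variation independence\<close>

lemma variation_independent_iff: "variation_independent V P \<longleftrightarrow> variation_independent W Q"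
proof
  assume *: "variation_independent V P"
  have "\<eta> \<in> mll_vector W Q ` positive_dists W" if "\<eta> \<in> extensional Q" for \<eta>
  proof -
    \<comment> \<open>Only slice 0 of the preimage is read; the value 0 at \<open>{v}\<close> and
      the copy of \<open>\<eta>\<close> in slice 1 are arbitrary fillers.\<close>
    have "join_params 0 \<eta> \<eta> \<in> P \<rightarrow>\<^sub>E UNIV" using join_params_extensional by (simp add: PiE_def)
    then obtain p where p: "p \<in> positive_dists V" "join_params 0 \<eta> \<eta> = mll_vector V P p"
      using * unfolding variation_independent_def by blast
    then have "\<eta> = mll_vector W Q (cond_dist V v p 0)"
      using slice_params_mll_vector(1)[OF p(1)] slice_join_params(1)[OF that that, of 0] by simp
    then show ?thesis using cond_dist_in_positive_dists[OF finite_V v p(1)] by blast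
  qed
  then show "variation_independent W Q"
    unfolding variation_independent_def using mll_vector_extensional by (auto simp: PiE_def)
next
  assume *: "variation_independent W Q"
  have "\<xi> \<in> mll_vector V P ` positive_dists V" if "\<xi> \<in> extensional P" for \<xi>
  proof -
    have "slice_params i \<xi> \<in> mll_vector W Q ` positive_dists W" for i :: nat
      using * by (auto simp: variation_independent_def slice_params_def PiE_def)
    from this[of 0] this[of 1] obtain q0 q1 where q: "q0 \<in> positive_dists W" "q1 \<in> positive_dists W"
      "slice_params 0 \<xi> = mll_vector W Q q0" "slice_params 1 \<xi> = mll_vector W Q q1" by (elim imageE) blast
    then have "\<xi> = mll_vector V P (mixture V v (weight (\<xi> ({v}, N)) q0 q1) q0 q1)"
      using mll_vector_mixture_weight[OF q(1,2)] join_slice_params[OF that] by simp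
    then show ?thesis using mixture_in_positive_dists[OF v q(1,2) weight_bounds] by blast
  qed
  then show "variation_independent V P"
    unfolding variation_independent_def using mll_vector_extensional by (auto simp: PiE_def)
qed

section \<open>Transfer of injectivity of the derivative\<close>

lemma nondegenerate_iff: "nondegenerate V P \<longleftrightarrow> nondegenerate W Q"
proof
  assume *: "nondegenerate W Q"
  show "nondegenerate V P"
    unfolding nondegenerate_def
  proof (intro ballI allI impI)
    fix p d x
    assume p: "p \<in> positive_dists V" and d: "(\<Sum>x\<in>states V. d x) = 0"
      and D: "\<forall>(L, M)\<in>P. mll_deriv V p d L M = 0" and x: "x \<in> states V"
    have pos: "0 < p (y(v := i))" if "y \<in> states W" "i \<in> {0, 1}" for y i
      using positive_distsD(1)[OF p upd_in_states[OF that(1) v that(2)]] .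
    let ?D = "\<lambda>i. mll_deriv W (\<lambda>x. p (x(v := i))) (\<lambda>x. d (x(v := i)))"
    \<comment> \<open>The derivatives at \<open>A\<close> and \<open>insert v A\<close> are half the
      sum and half the difference of those of the slices; when both vanish, so do the
      latter.\<close>
    have Dslice: "?D 0 A M = 0 \<and> ?D 1 A M = 0" if "(A, M) \<in> Q" for A M
    proof -
      have M: "(A, insert v M) \<in> P" "v \<notin> A" "v \<notin> M" using that Q_iff by auto
      then have "insert v M \<subseteq> V" "A \<subseteq> insert v M - {v}" using pairD[OF M(1)] by auto
      note split = mll_deriv_split[OF finite_V insertI1 this] mll_deriv_split_insert[OF finite_V insertI1 this]
      have "mll_deriv V p d A (insert v M) = 0" "mll_deriv V p d (insert v A) (insert v M) = 0"
        using D M(1) insert_pair(1)[OF M(1,2)] by auto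
      then show ?thesis using M(3) unfolding split by simp
    qed
    \<comment> \<open>A slice of \<open>d\<close> may have nonzero total, so it is only known to be
      a multiple of the slice of \<open>p\<close>.\<close>
    have "\<exists>k. \<forall>y\<in>states W. d (y(v := i)) = k * p (y(v := i))" if "i \<in> {0, 1}" for i
    proof (rule nondegenerate_proportional[OF _ Q_pairs *])
      show "0 < p (y(v := i))" if "y \<in> states W" for y using that \<open>i \<in> {0, 1}\<close> by (rule pos)
      show "?D i L M = 0" if "(L, M) \<in> Q" for L M using Dslice[OF that] \<open>i \<in> {0, 1}\<close> by auto
    qed (use finite_V in auto)
    then obtain k0 k1 where k: "\<And>y. y \<in> states W \<Longrightarrow> d (y(v := 0)) = k0 * p (y(v := 0))"
        "\<And>y. y \<in> states W \<Longrightarrow> d (y(v := 1)) = k1 * p (y(v := 1))"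
      by (metis insertI1 insertI2)
    have "v \<in> N" "N \<subseteq> V" "{} \<subseteq> N - {v}" "N - {v} \<subseteq> W" using pairD[OF N] by auto
    note N' = this
    have k': "mll_deriv W (\<lambda>x. p (x(v := i))) (\<lambda>x. d (x(v := i))) {} (N - {v}) = k"
      if "i \<in> {0, 1}" "\<And>y. y \<in> states W \<Longrightarrow> d (y(v := i)) = k * p (y(v := i))" for i k
    proof -
      have "mll_deriv W (\<lambda>x. p (x(v := i))) (\<lambda>x. d (x(v := i))) {} (N - {v}) =
          mll_deriv W (\<lambda>x. p (x(v := i))) (\<lambda>x. k * p (x(v := i))) {} (N - {v})"
        using that by (intro mll_deriv_cong) auto
      also have "\<dots> = k"
        unfolding mll_deriv_cmult using mll_deriv_self[OF _ N'(4,3) pos[OF _ that(1)]] finite_V by simp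
      finally show ?thesis .
    qed
    \<comment> \<open>The empty effect reads off the factors \<open>k0\<close> and
      \<open>k1\<close>, and \<open>{v}\<close> compares them. Once they agree, total zero forces
      the common factor to be 0.\<close>
    have "mll_deriv V p d (insert v {}) N = 0" using D N by auto
    then have "k0 = k1"
      unfolding mll_deriv_split_insert[OF finite_V N'(1-3)] using k'[OF _ k(1)] k'[OF _ k(2)] by simp
    have "0 = (\<Sum>y\<in>states W. k0 * p (y(v := 0))) + (\<Sum>y\<in>states W. k1 * p (y(v := 1)))"
      using d k unfolding sum_states_split[OF v] by simp
    also have "\<dots> = k0 * (\<Sum>x\<in>states V. p x)"
      unfolding sum_states_split[OF v] \<open>k0 = k1\<close> by (simp add: distrib_left sum_distrib_left)
    finally have "k0 = 0" using positive_distsD(2)[OF p] by simp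
    moreover obtain y i where "y \<in> states W" "i \<in> {0, 1}" "x = y(v := i)"
      using x by (rule state_cases[OF v])
    ultimately show "d x = 0" using k \<open>k0 = k1\<close> by auto
  qed
next
  assume *: "nondegenerate V P"
  show "nondegenerate W Q"
    unfolding nondegenerate_def
  proof (intro ballI allI impI)
    fix q d x
    assume q: "q \<in> positive_dists W" and d: "(\<Sum>x\<in>states W. d x) = 0"
      and D: "\<forall>(L, M)\<in>Q. mll_deriv W q d L M = 0" and x: "x \<in> states W"
    have fin: "finite W" using finite_V by simp
    note self = mll_deriv_self[OF fin _ _ positive_distsD(1)[OF q]]
    text \<open>The multiple \<open>s\<close> of \<open>q\<close> moved between the slices makes the parameter of \<open>{v}\<close> stationary.\<close>
    define s where "s = - mll_deriv W q d {} (N - {v}) / 2"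
    \<comment> \<open>Both slices of the base point are \<open>q / 2\<close>. The direction moves
      slice 0 by \<open>d\<close>; the added multiples of \<open>q\<close> have opposite totals and
      are seen by the empty effect only.\<close>
    let ?p = "mixture V v (1 / 2) q q"
    let ?e = "\<lambda>x. if x v = 0 then d (restrict x W) + s * q (restrict x W) else (- s) * q (restrict x W)"
    have e: "?e (y(v := 0)) = d y + s * q y" "?e (y(v := 1)) = (- s) * q y" if "y \<in> states W" for y
      using that by (simp_all add: restrict_state)
    have p: "?p (y(v := 0)) = (1 / 2) * q y" "?p (y(v := 1)) = (1 / 2) * q y" if "y \<in> states W" for y
      using mixture_upd[OF v that, of "1 / 2" q q] by simp_all
    have slice: "mll_deriv W (\<lambda>x. ?p (x(v := 0))) (\<lambda>x. ?e (x(v := 0))) A M =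
          2 * (mll_deriv W q d A M + s * mll_deriv W q q A M)"
        "mll_deriv W (\<lambda>x. ?p (x(v := 1))) (\<lambda>x. ?e (x(v := 1))) A M = - 2 * s * mll_deriv W q q A M" for A M
    proof -
      have "mll_deriv W (\<lambda>x. ?p (x(v := 0))) (\<lambda>x. ?e (x(v := 0))) A M =
          mll_deriv W (\<lambda>x. (1 / 2) * q x) (\<lambda>x. d x + s * q x) A M"
        by (intro mll_deriv_cong p e)
      then show "mll_deriv W (\<lambda>x. ?p (x(v := 0))) (\<lambda>x. ?e (x(v := 0))) A M =
          2 * (mll_deriv W q d A M + s * mll_deriv W q q A M)"
        by (simp only: mll_deriv_base_cmult mll_deriv_add mll_deriv_cmult) simp
      have "mll_deriv W (\<lambda>x. ?p (x(v := 1))) (\<lambda>x. ?e (x(v := 1))) A M =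
          mll_deriv W (\<lambda>x. (1 / 2) * q x) (\<lambda>x. (- s) * q x) A M"
        by (intro mll_deriv_cong p e)
      then show "mll_deriv W (\<lambda>x. ?p (x(v := 1))) (\<lambda>x. ?e (x(v := 1))) A M = - 2 * s * mll_deriv W q q A M"
        by (simp only: mll_deriv_base_cmult mll_deriv_cmult) simp
    qed
    have "mll_deriv V ?p ?e L M = 0" if LM: "(L, M) \<in> P" for L M
    proof -
      have M: "M \<subseteq> V" "M - {v} \<subseteq> W" "v \<in> M" "L \<subseteq> M" using pairD[OF LM] v_in_margin[OF LM] by auto
      note split = mll_deriv_split[OF finite_V M(3,1)] mll_deriv_split_insert[OF finite_V M(3,1)]
      from LM show ?thesis
      proof (cases rule: pair_cases)
        \<comment> \<open>With \<open>m = mll_deriv W q d {} (N - {v})\<close> the derivative at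
          \<open>{v}\<close> is \<open>m + 2 * s\<close>, which explains the choice
          \<open>s = - m / 2\<close>.\<close>
        case vertex
        then show ?thesis
          using split(2)[of "{}" ?p ?e] self[OF M(2), of "{}"] unfolding slice by (simp add: s_def)
      next
        case without
        then have L: "L \<subseteq> M - {v}" "L \<noteq> {}" using M pairD[OF LM] by auto
        have "mll_deriv W q d L (M - {v}) = 0" using D without by auto
        then show ?thesis using L split(1)[OF L(1), of ?p ?e] self[OF M(2) L(1)] unfolding slice by simp
      next
        case ("with" A)
        then have A: "A \<subseteq> M - {v}" "A \<noteq> {}" using M by auto
        have "mll_deriv W q d A (M - {v}) = 0" using D "with" by auto
        then show ?thesis using A "with" split(2)[OF A(1), of ?p ?e] self[OF M(2) A(1)] unfolding slice by simp
      qed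
    qed
    moreover have "(\<Sum>x\<in>states V. ?e x) = 0"
    proof -
      have "(\<Sum>y\<in>states W. ?e (y(v := 0))) = (\<Sum>y\<in>states W. d y + s * q y)"
        by (intro sum.cong refl e)
      also have "\<dots> = s"
        using d positive_distsD(2)[OF q] by (simp add: sum.distrib flip: sum_distrib_left)
      finally have e0: "(\<Sum>y\<in>states W. ?e (y(v := 0))) = s" .
      have "(\<Sum>y\<in>states W. ?e (y(v := 1))) = (\<Sum>y\<in>states W. (- s) * q y)"
        by (intro sum.cong refl e)
      also have "\<dots> = - s"
        using positive_distsD(2)[OF q] unfolding sum_distrib_left[symmetric] by simp
      finally show ?thesis unfolding sum_states_split[OF v] e0 by simp
    qed
    moreover have "?p \<in> positive_dists V" by (rule mixture_in_positive_dists[OF v q q]) auto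
    ultimately have zero: "\<forall>x\<in>states V. ?e x = 0"
      using * unfolding nondegenerate_def by blast
    \<comment> \<open>Slice 1 gives \<open>s * q x = 0\<close>, and slice 0 then leaves
      \<open>d x = 0\<close>.\<close>
    have "?e (x(v := i)) = 0" if "i \<in> {0, 1}" for i
      using zero upd_in_states[OF x v that] by blast
    note this[of 0, unfolded e(1)[OF x]] this[of 1, unfolded e(2)[OF x]]
    then show "d x = 0" by auto
  qed
qed

section \<open>Transfer of the homeomorphism\<close>

lemma continuous_map_slice_params: "continuous_map (powertop_real P) (powertop_real Q) (slice_params i)"
  unfolding continuous_map_componentwise
proof (intro conjI ballI)
  show "slice_params i ` topspace (powertop_real P) \<subseteq> extensional Q" by (auto simp: slice_params_def)
  fix j assume j: "j \<in> Q"
  obtain A M where AM: "j = (A, M)" by force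
  then have "(A, insert v M) \<in> P" "(insert v A, insert v M) \<in> P"
    using j Q_iff insert_pair(1) by auto
  note c = this[THEN continuous_map_product_projection[of _ P "\<lambda>_. euclideanreal"]]
  have "continuous_map (powertop_real P) euclideanreal
      (\<lambda>\<xi>. \<xi> (A, insert v M) + (-1) ^ i * \<xi> (insert v A, insert v M))"
    by (intro continuous_map_add continuous_map_real_mult c) simp
  then show "continuous_map (powertop_real P) euclideanreal (\<lambda>\<xi>. slice_params i \<xi> j)"
    using j by (simp add: AM slice_params_def)
qed

lemma continuous_map_join_params:
  assumes "continuous_map Z euclideanreal t"
    and "continuous_map Z (powertop_real Q) \<eta>0" "continuous_map Z (powertop_real Q) \<eta>1"
  shows "continuous_map Z (powertop_real P) (\<lambda>z. join_params (t z) (\<eta>0 z) (\<eta>1 z))"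
  unfolding continuous_map_componentwise
proof (intro conjI ballI)
  show "(\<lambda>z. join_params (t z) (\<eta>0 z) (\<eta>1 z)) ` topspace Z \<subseteq> extensional P"
    by (auto simp: join_params_def)
  fix j assume j: "j \<in> P"
  obtain L M where LM: "j = (L, M)" by force
  then have "(L, M) \<in> P" using j by simp
  then show "continuous_map Z euclideanreal (\<lambda>z. join_params (t z) (\<eta>0 z) (\<eta>1 z) j)"
  proof (cases rule: pair_cases)
    case vertex
    then show ?thesis using assms(1) by (simp add: LM join_params_vertex)
  next
    case without
    note c = assms(2,3)[THEN continuous_map_component, OF without(3)]
    show ?thesis
      using j without unfolding LM
      by (subst join_params_without) (auto intro!: continuous_map_real_divide continuous_map_add c)
  next
    case ("with" A)
    note c = assms(2,3)[THEN continuous_map_component, OF "with"(6)]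
    show ?thesis
      using j "with" unfolding LM \<open>L = insert v A\<close>
      by (subst join_params_with) (auto intro!: continuous_map_real_divide continuous_map_diff c)
  qed
qed

text \<open>Through each \<open>\<xi>\<close> in \<open>U\<close> runs a continuous section of
  \<open>slice_params 0\<close>: freeze the value at \<open>{v}\<close> and slice 1, and vary slice
  0. The preimage of \<open>U\<close> under it is a neighbourhood inside the image.\<close>

lemma openin_slice_params_image:
  assumes "openin (powertop_real P) U"
  shows "openin (powertop_real Q) (slice_params 0 ` U)"
proof (subst openin_subopen, intro ballI)
  fix \<eta> assume "\<eta> \<in> slice_params 0 ` U"
  then obtain \<xi> where \<xi>: "\<xi> \<in> U" "\<eta> = slice_params 0 \<xi>" by blast
  then have ext: "\<xi> \<in> extensional P" using openin_subset[OF assms] by (auto simp: PiE_def)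
  let ?s = "\<lambda>\<eta>'. join_params (\<xi> ({v}, N)) \<eta>' (slice_params 1 \<xi>)"
  have sl: "slice_params i \<xi> \<in> topspace (powertop_real Q)" for i
    by (auto simp: slice_params_def)
  have "continuous_map (powertop_real Q) (powertop_real P) ?s"
    by (intro continuous_map_join_params continuous_map_const[THEN iffD2] continuous_map_id[unfolded id_def]
        disjI2 sl) simp
  then have "openin (powertop_real Q) {\<eta>' \<in> topspace (powertop_real Q). ?s \<eta>' \<in> U}"
    using assms by (rule openin_continuous_map_preimage)
  moreover have "\<eta> \<in> {\<eta>' \<in> topspace (powertop_real Q). ?s \<eta>' \<in> U}"
    using \<xi> sl join_slice_params[OF ext] by simp
  moreover have "{\<eta>' \<in> topspace (powertop_real Q). ?s \<eta>' \<in> U} \<subseteq> slice_params 0 ` U"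
  proof
    fix \<eta>' assume \<eta>': "\<eta>' \<in> {\<eta>' \<in> topspace (powertop_real Q). ?s \<eta>' \<in> U}"
    then have "\<eta>' \<in> extensional Q" "slice_params 1 \<xi> \<in> extensional Q"
      by (auto simp: PiE_def slice_params_def)
    then have "\<eta>' = slice_params 0 (?s \<eta>')" by (simp add: slice_join_params(1))
    then show "\<eta>' \<in> slice_params 0 ` U" using \<eta>' by blast
  qed
  ultimately show "\<exists>T. openin (powertop_real Q) T \<and> \<eta> \<in> T \<and> T \<subseteq> slice_params 0 ` U" by blast
qed

lemma continuous_map_weight:
  assumes "continuous_map Z euclideanreal t"
    and "continuous_map Z (dist_topology W) q0" "continuous_map Z (dist_topology W) q1"
  shows "continuous_map Z euclideanreal (\<lambda>z. weight (t z) (q0 z) (q1 z))"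
proof -
  have sub: "N - {v} \<subseteq> W" using pairD[OF N] by auto
  have "continuous_map Z euclideanreal (\<lambda>z. \<mu> (q z))" if q: "continuous_map Z (dist_topology W) q" for q
  proof (rule continuous_map_mll_param[OF _ sub])
    show "continuous_map Z euclideanreal (\<lambda>z. q z x)" if "x \<in> states W" for x
      using continuous_map_dist_component[OF q that] .
    show "0 < q z x" if "z \<in> topspace Z" "x \<in> states W" for z x
      using q that positive_distsD(1) by (auto simp: continuous_map_in_subtopology)
  qed (use finite_V in simp)
  then show ?thesis
    unfolding weight_def using assms
    by (intro continuous_map_real_compose[OF _ continuous_on_logistic] continuous_map_add
        continuous_map_diff continuous_map_real_mult) auto
qed

lemma homeomorphic_lift:
  assumes "openin (powertop_real Q) \<Theta>"
    and "homeomorphic_map (dist_topology W) (subtopology (powertop_real Q) \<Theta>) (mll_vector W Q)"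
  obtains \<Theta>' where "openin (powertop_real P) \<Theta>'"
    "homeomorphic_map (dist_topology V) (subtopology (powertop_real P) \<Theta>') (mll_vector V P)"
proof
  \<comment> \<open>Both slices must be attainable over \<open>W\<close>, while the coordinate at
    \<open>{v}\<close> is unrestricted.\<close>
  let ?\<Theta> = "{\<xi> \<in> topspace (powertop_real P). slice_params 0 \<xi> \<in> \<Theta>} \<inter>
    {\<xi> \<in> topspace (powertop_real P). slice_params 1 \<xi> \<in> \<Theta>}"
  show "openin (powertop_real P) ?\<Theta>"
    by (intro openin_Int openin_continuous_map_preimage[OF continuous_map_slice_params assms(1)])
  obtain g where g: "homeomorphic_maps (dist_topology W) (subtopology (powertop_real Q) \<Theta>) (mll_vector W Q) g"
    using assms(2) homeomorphic_map_maps by blast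
  have \<Theta>: "topspace (subtopology (powertop_real Q) \<Theta>) = \<Theta>"
    using openin_subset[OF assms(1)] by auto
  have gq: "g \<eta> \<in> positive_dists W" "mll_vector W Q (g \<eta>) = \<eta>" if "\<eta> \<in> \<Theta>" for \<eta>
    using g that topspace_dist_topology[of W] unfolding homeomorphic_maps_def continuous_map_def \<Theta> by blast+
  have qg: "g (mll_vector W Q q) = q" "mll_vector W Q q \<in> \<Theta>" if "q \<in> positive_dists W" for q
    using g that topspace_dist_topology[of W] unfolding homeomorphic_maps_def continuous_map_def \<Theta> by blast+
  let ?q = "\<lambda>i \<xi>. g (slice_params i \<xi>)"
  \<comment> \<open>The explicit inverse: invert both slices by \<open>g\<close>, then choose the
    weight that yields the given value at \<open>{v}\<close>.\<close>
  let ?g = "\<lambda>\<xi>. mixture V v (weight (\<xi> ({v}, N)) (?q 0 \<xi>) (?q 1 \<xi>)) (?q 0 \<xi>) (?q 1 \<xi>)"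
  let ?Z = "subtopology (powertop_real P) ?\<Theta>"
  have "homeomorphic_maps (dist_topology V) ?Z (mll_vector V P) ?g"
    unfolding homeomorphic_maps_def
  proof (intro conjI ballI)
    have "mll_vector V P p \<in> ?\<Theta>" if "p \<in> positive_dists V" for p
      using qg(2)[OF cond_dist_in_positive_dists[OF finite_V v that]] slice_params_mll_vector[OF that]
        mll_vector_extensional by (auto simp: PiE_def)
    then show "continuous_map (dist_topology V) ?Z (mll_vector V P)"
      unfolding continuous_map_in_subtopology topspace_dist_topology
      using continuous_map_mll_vector_dist[OF finite_V pairs] by blast
    have c: "continuous_map ?Z (dist_topology W) (?q i)" if "i \<in> {0, 1}" for i
    proof -
      have "continuous_map ?Z (subtopology (powertop_real Q) \<Theta>) (slice_params i)"
        unfolding continuous_map_in_subtopology[of _ _ \<Theta>]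
        using that by (auto intro: continuous_map_from_subtopology continuous_map_slice_params)
      moreover have "continuous_map (subtopology (powertop_real Q) \<Theta>) (dist_topology W) g"
        using g by (simp add: homeomorphic_maps_def)
      ultimately show ?thesis using continuous_map_compose unfolding o_def by blast
    qed
    show "continuous_map ?Z (dist_topology V) ?g"
      using c weight_bounds continuous_map_coord[OF N]
      by (intro continuous_map_mixture[OF v] continuous_map_weight) auto
  next
    fix p assume "p \<in> topspace (dist_topology V)"
    then have p: "p \<in> positive_dists V" by (simp only: topspace_dist_topology)
    then show "?g (mll_vector V P p) = p"
      using qg(1)[OF cond_dist_in_positive_dists[OF finite_V v p]] mixture_weight_cond_dist[OF p]
      by (simp add: slice_params_mll_vector(1,2)[OF p])
  next
    fix \<xi> assume "\<xi> \<in> topspace ?Z"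
    then have "\<xi> \<in> extensional P" "slice_params 0 \<xi> \<in> \<Theta>" "slice_params 1 \<xi> \<in> \<Theta>"
      by (auto simp: PiE_def)
    then show "mll_vector V P (?g \<xi>) = \<xi>"
      using mll_vector_mixture_weight[OF gq(1) gq(1)] gq(2) join_slice_params by simp
  qed
  then show "homeomorphic_map (dist_topology V) ?Z (mll_vector V P)"
    using homeomorphic_map_maps by blast
qed

text \<open>Instead of an inverse, openness of the map is shown: the image of \<open>U\<close> is
  slice 0 of the image of all \<open>p\<close> whose conditional law given \<open>X_v = 0\<close>
  lies in \<open>U\<close>. These \<open>p\<close> form an open set, and both maps applied to it are
  open.\<close>

lemma homeomorphic_descend:
  assumes "openin (powertop_real P) \<Theta>"
    and "homeomorphic_map (dist_topology V) (subtopology (powertop_real P) \<Theta>) (mll_vector V P)"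
  obtains \<Theta>' where "openin (powertop_real Q) \<Theta>'"
    "homeomorphic_map (dist_topology W) (subtopology (powertop_real Q) \<Theta>') (mll_vector W Q)"
proof
  let ?\<Theta> = "slice_params 0 ` \<Theta>"
  let ?mix = "\<lambda>q. mixture V v (1 / 2) q q"
  show \<Theta>': "openin (powertop_real Q) ?\<Theta>"
    by (rule openin_slice_params_image[OF assms(1)])
  have \<Theta>: "topspace (subtopology (powertop_real P) \<Theta>) = \<Theta>"
    "topspace (subtopology (powertop_real Q) ?\<Theta>) = ?\<Theta>"
    using openin_subset[OF assms(1)] openin_subset[OF \<Theta>'] by auto
  have mix: "?mix q \<in> positive_dists V" "cond_dist V v (?mix q) 0 = q" if "q \<in> positive_dists W" for q
    using mixture_in_positive_dists[OF v that that] cond_dist_mixture(1)[OF v that that] by auto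
  have surj: "mll_vector V P ` positive_dists V = \<Theta>"
    using homeomorphic_imp_surjective_map[OF assms(2)] unfolding topspace_dist_topology \<Theta> .
  have inj: "inj_on (mll_vector V P) (positive_dists V)"
    using homeomorphic_imp_injective_map[OF assms(2)] unfolding topspace_dist_topology .
  \<comment> \<open>Every \<open>q\<close> in \<open>U\<close> is a conditional law of some
    \<open>p\<close>, for instance of the even mixture of \<open>q\<close> with itself.\<close>
  have image: "mll_vector W Q ` U = slice_params 0 ` mll_vector V P `
      {p \<in> topspace (dist_topology V). cond_dist V v p 0 \<in> U}"
    if U: "U \<subseteq> positive_dists W" for U
  proof -
    have "U = (\<lambda>p. cond_dist V v p 0) ` {p \<in> positive_dists V. cond_dist V v p 0 \<in> U}"
      using U mix by (force simp: image_iff)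
    then have "mll_vector W Q ` U =
        (\<lambda>p. mll_vector W Q (cond_dist V v p 0)) ` {p \<in> positive_dists V. cond_dist V v p 0 \<in> U}"
      by (metis image_image)
    also have "\<dots> = (\<lambda>p. slice_params 0 (mll_vector V P p)) ` {p \<in> positive_dists V. cond_dist V v p 0 \<in> U}"
      by (intro image_cong) (auto simp: slice_params_mll_vector(1))
    finally show ?thesis unfolding topspace_dist_topology by (simp add: image_image)
  qed
  have surj': "mll_vector W Q ` positive_dists W = ?\<Theta>"
  proof -
    have "{p \<in> positive_dists V. cond_dist V v p 0 \<in> positive_dists W} = positive_dists V"
      using cond_dist_in_positive_dists[OF finite_V v] by auto
    then show ?thesis
      unfolding image[OF order_refl] topspace_dist_topology using surj by simp
  qed
  show "homeomorphic_map (dist_topology W) (subtopology (powertop_real Q) ?\<Theta>) (mll_vector W Q)"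
  proof (rule bijective_open_imp_homeomorphic_map)
    show "continuous_map (dist_topology W) (subtopology (powertop_real Q) ?\<Theta>) (mll_vector W Q)"
      unfolding continuous_map_in_subtopology topspace_dist_topology
      using continuous_map_mll_vector_dist[OF _ Q_pairs] finite_V surj' by blast
    show "mll_vector W Q ` topspace (dist_topology W) = topspace (subtopology (powertop_real Q) ?\<Theta>)"
      unfolding topspace_dist_topology \<Theta> by (rule surj')
    show "open_map (dist_topology W) (subtopology (powertop_real Q) ?\<Theta>) (mll_vector W Q)"
      unfolding open_map_def
    proof (intro allI impI)
      fix U assume U: "openin (dist_topology W) U"
      let ?U = "{p \<in> topspace (dist_topology V). cond_dist V v p 0 \<in> U}"
      have "openin (dist_topology V) ?U"
        by (rule openin_continuous_map_preimage[OF continuous_map_cond_dist[OF finite_V v] U]) simp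
      then have "openin (subtopology (powertop_real P) \<Theta>) (mll_vector V P ` ?U)"
        using homeomorphic_imp_open_map[OF assms(2)] unfolding open_map_def by blast
      then have "openin (powertop_real P) (mll_vector V P ` ?U)"
        using openin_open_subtopology[OF assms(1)] by blast
      then have "openin (powertop_real Q) (slice_params 0 ` mll_vector V P ` ?U)"
        by (rule openin_slice_params_image)
      moreover have "U \<subseteq> positive_dists W"
        using openin_subset[OF U] unfolding topspace_dist_topology .
      ultimately have "openin (powertop_real Q) (mll_vector W Q ` U)" using image by simp
      moreover have "mll_vector W Q ` U \<subseteq> ?\<Theta>" using \<open>U \<subseteq> positive_dists W\<close> surj' by blast
      ultimately show "openin (subtopology (powertop_real Q) ?\<Theta>) (mll_vector W Q ` U)"
        using openin_open_subtopology[OF \<Theta>'] by blast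
    qed
    show "inj_on (mll_vector W Q) (topspace (dist_topology W))"
      unfolding topspace_dist_topology
    proof (rule inj_onI)
      fix q q' assume q: "q \<in> positive_dists W" "q' \<in> positive_dists W"
        and eq: "mll_vector W Q q = mll_vector W Q q'"
      \<comment> \<open>Both mixtures share slice 1, and their weights are fitted to give the value
        0 at \<open>{v}\<close>. One fixed weight would not do, since \<open>\<mu> q\<close> and
        \<open>\<mu> q'\<close> are not known to agree.\<close>
      have "mll_vector V P (mixture V v (weight 0 q q) q q) = mll_vector V P (mixture V v (weight 0 q' q) q' q)"
        using mll_vector_mixture_weight q eq by simp
      then have "mixture V v (weight 0 q q) q q = mixture V v (weight 0 q' q) q' q"
        by (rule inj_onD[OF inj]) (rule mixture_in_positive_dists[OF v _ _ weight_bounds], rule q, rule q)+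
      then have "cond_dist V v (mixture V v (weight 0 q q) q q) 0 =
          cond_dist V v (mixture V v (weight 0 q' q) q' q) 0"
        by (rule arg_cong)
      then show "q = q'"
        unfolding cond_dist_mixture(1)[OF v q(1) q(1) weight_bounds[of 0 q q]]
          cond_dist_mixture(1)[OF v q(2) q(1) weight_bounds[of 0 q' q]] .
    qed
  qed
qed

lemma smooth_parameterization_iff:
  "smooth_parameterization V P (mll_vector V P) \<longleftrightarrow> smooth_parameterization W Q (mll_vector W Q)"
  unfolding smooth_parameterization_mll_vector_iff[OF finite_V complete]
    smooth_parameterization_mll_vector_iff[OF finite_Diff[OF finite_V] complete_Q] nondegenerate_iff
proof (intro conj_cong refl iffI; elim exE conjE)
  fix \<Theta>
  assume "openin (powertop_real P) \<Theta>"
    "homeomorphic_map (dist_topology V) (subtopology (powertop_real P) \<Theta>) (mll_vector V P)"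
  then show "\<exists>\<Theta>. openin (powertop_real Q) \<Theta> \<and>
      homeomorphic_map (dist_topology W) (subtopology (powertop_real Q) \<Theta>) (mll_vector W Q)"
    by (rule homeomorphic_descend) blast
next
  fix \<Theta>
  assume "openin (powertop_real Q) \<Theta>"
    "homeomorphic_map (dist_topology W) (subtopology (powertop_real Q) \<Theta>) (mll_vector W Q)"
  then show "\<exists>\<Theta>. openin (powertop_real P) \<Theta> \<and>
      homeomorphic_map (dist_topology V) (subtopology (powertop_real P) \<Theta>) (mll_vector V P)"
    by (rule homeomorphic_lift) blast
qed

end

theorem proposition3p8:
  fixes V :: "'a set" and P :: "('a set \<times> 'a set) set" and v :: 'a
  assumes "finite V"
    and "complete_pairs V P"
    and "v \<in> V"
    and "\<And>A. A \<noteq> {} \<Longrightarrow> A \<subseteq> V - {v} \<Longrightarrow> within_same_margin P (A \<union> {v}) A"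
  shows "(smooth_parameterization V P (mll_vector V P) \<longleftrightarrow>
            smooth_parameterization (V - {v}) (remove_vertex v P)
              (mll_vector (V - {v}) (remove_vertex v P)))
       \<and> (variation_independent V P \<longleftrightarrow>
            variation_independent (V - {v}) (remove_vertex v P))"
proof -
  interpret vertex_split V P v using assms by unfold_locales
  show ?thesis using smooth_parameterization_iff variation_independent_iff by blast
qed

end
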